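(* Let $k$ be an algebraically closed field, let $R=k[x_1,\ldots,x_n]$, and let $I$ be an ideal of $R$. Then, for every positive integer $q$, $$I\subseteq\Phi^{*}_{q+1}(I)\subseteq\Phi^{*}_q(I)\subseteq\sqrt I,\qquad \sqrt{\Phi^{*}_q(I)}=\sqrt I,\qquad \Phi^{*}_1(I)=\sqrt I.$$ Moreover, there exists an integer $e=e(I)\ge 1$ such that $\Phi^{*}_q(I)=I$ for every $q\ge e$. Consequently, $$\bigcap_{q\ge 1}\Phi^{*}_q(I)=I.$$
   Context: For $a=(a_1,\ldots,a_n)\in k^n$, $\mathfrak{m}_a=(x_1-a_1,\ldots,x_n-a_n)\subseteq R$. For every integer $q\ge1$ and every ideal $I$ of $R$, $\Phi^{*}_q(I)=\bigcap_{a\in k^n}(I+\mathfrak{m}_a^q)$. *)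

theory Defs
  imports
    "HOL-Library.Poly_Mapping"
    "HOL-Library.FuncSet"
    "HOL-Computational_Algebra.Polynomial"
    "HOL-Algebra.Ideal_Product"
begin

text \<open>
  Polynomials in the variables $x_0, x_1, \ldots$ with coefficients in \<open>'k\<close>: finitely supported maps
  from exponent vectors to coefficients, multiplied by convolution. The variables are numbered
  from 0, so that the polynomial ring in $n$ variables uses the indices \<open>i < n\<close>.
\<close>

type_synonym 'k mpoly = "(nat \<Rightarrow>\<^sub>0 nat) \<Rightarrow>\<^sub>0 'k"

definition const :: "'k::comm_ring_1 \<Rightarrow> 'k mpoly"
  where "const c = Poly_Mapping.single 0 c"

definition var :: "nat \<Rightarrow> 'k::comm_ring_1 mpoly"
  where "var i = Poly_Mapping.single (Poly_Mapping.single i 1) 1"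

definition poly_ring :: "nat \<Rightarrow> 'k::comm_ring_1 mpoly ring"
  where "poly_ring n =
    \<lparr>carrier = {p. \<forall>m\<in>Poly_Mapping.keys p. Poly_Mapping.keys m \<subseteq> {..<n}},
     monoid.mult = (*), one = 1, ring.zero = 0, add = (+)\<rparr>"

definition affine_space :: "nat \<Rightarrow> (nat \<Rightarrow> 'k) set"
  where "affine_space n = {..<n} \<rightarrow>\<^sub>E UNIV"

definition point_ideal :: "nat \<Rightarrow> (nat \<Rightarrow> 'k::comm_ring_1) \<Rightarrow> 'k mpoly set"
  where "point_ideal n a = Idl\<^bsub>poly_ring n\<^esub> ((\<lambda>i. var i - const (a i)) ` {..<n})"

definition radical :: "('a, 'b) ring_scheme \<Rightarrow> 'a set \<Rightarrow> 'a set"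
  where "radical R I = {f \<in> carrier R. \<exists>m::nat. m > 0 \<and> f [^]\<^bsub>R\<^esub> m \<in> I}"

text \<open>
  The power of the point ideal is taken in the multiplicative monoid of ideals, i.e. it is an
  iterated ideal product, whose zeroth power is the whole ring.
\<close>

definition Phi_star :: "nat \<Rightarrow> nat \<Rightarrow> 'k::comm_ring_1 mpoly set \<Rightarrow> 'k mpoly set"
  where "Phi_star n q I =
    (\<Inter>a\<in>affine_space n.
      I <+>\<^bsub>poly_ring n\<^esub> (point_ideal n a [^]\<^bsub>ideals_set (poly_ring n)\<^esub> q))"

lemma mult_in_poly_ring:
  fixes p q :: "'k::comm_ring_1 mpoly"
  assumes "p \<in> carrier (poly_ring n)" "q \<in> carrier (poly_ring n)"
  shows "p * q \<in> carrier (poly_ring n)"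
proof -
  have "Poly_Mapping.keys m \<subseteq> {..<n}" if m: "m \<in> Poly_Mapping.keys (p * q)" for m
  proof -
    obtain a b where "a \<in> Poly_Mapping.keys p" "b \<in> Poly_Mapping.keys q" "m = a + b"
      using keys_mult[of p q] m by blast
    then show ?thesis
      using assms keys_add[of a b] by (fastforce simp: poly_ring_def)
  qed
  then show ?thesis
    by (simp add: poly_ring_def)
qed

lemma cring_poly_ring: "cring (poly_ring n :: 'k::comm_ring_1 mpoly ring)"
proof (rule cringI)
  show "abelian_group (poly_ring n :: 'k mpoly ring)"
  proof (rule abelian_groupI)
    fix x y :: "'k mpoly"
    assume x: "x \<in> carrier (poly_ring n)" and y: "y \<in> carrier (poly_ring n)"
    show "x \<oplus>\<^bsub>poly_ring n\<^esub> y \<in> carrier (poly_ring n)"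
      using x y Poly_Mapping.keys_add[of x y] by (auto simp: poly_ring_def)
    show "\<exists>y\<in>carrier (poly_ring n). y \<oplus>\<^bsub>poly_ring n\<^esub> x = \<zero>\<^bsub>poly_ring n\<^esub>"
      by (rule bexI[of _ "- x"]) (use x in \<open>auto simp: poly_ring_def\<close>)
  qed (auto simp: poly_ring_def add_ac)
  show "comm_monoid (poly_ring n :: 'k mpoly ring)"
  proof (rule comm_monoidI)
    fix x y :: "'k mpoly"
    assume "x \<in> carrier (poly_ring n)" "y \<in> carrier (poly_ring n)"
    then show "x \<otimes>\<^bsub>poly_ring n\<^esub> y \<in> carrier (poly_ring n)"
      using mult_in_poly_ring[of x n y] by (simp add: poly_ring_def)
  qed (auto simp: poly_ring_def mult_ac)
qed (simp add: poly_ring_def distrib_right)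

lemma const_in_poly_ring: "const c \<in> carrier (poly_ring n)"
  by (simp add: const_def poly_ring_def)

lemma var_in_poly_ring: "i < n \<Longrightarrow> var i \<in> carrier (poly_ring n)"
  by (simp add: var_def poly_ring_def)

lemma ideal_point_ideal: "ideal (point_ideal n a) (poly_ring n)"
proof -
  interpret cring "poly_ring n :: 'a mpoly ring"
    by (rule cring_poly_ring)
  have "var i - const (a i) \<in> carrier (poly_ring n)" if "i < n" for i
    using that keys_diff[of "var i" "const (a i)"] var_in_poly_ring[of i n]
      const_in_poly_ring[of "a i" n]
    by (auto simp: poly_ring_def)
  then show ?thesis
    unfolding point_ideal_def by (intro genideal_ideal) auto
qed

end

theory Submission
  imports Defs
begin

text \<open>
  The heart of the matter is that $\Phi^{*}_e(I) \subseteq I$ for a single $e$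
  (\<open>Phi_star_stabilizes\<close>); the rest is formal. If $f$ lies in every $I + \mathfrak{m}_a$, then
  $f^e$ lies in every $I + \mathfrak{m}_a^e$, hence in $I$. So $\Phi^{*}_1(I) \subseteq \sqrt I$,
  and Hilbert's Nullstellensatz is a consequence of stabilization rather than an ingredient.
  Conversely $f \equiv f(a)$ modulo $I + \mathfrak{m}_a$, so that $f^m \in I$ forces $f(a) = 0$
  or $I + \mathfrak{m}_a = R$; this gives $\sqrt I \subseteq \Phi^{*}_1(I)$.

  Stabilization is proved by Noetherian induction on $I$, the case $I = R$ being trivial. Let $S$
  be a maximal set of variables with $k[S] \cap I = 0$. If some nonzero $b \in k[S]$ is a zero
  divisor modulo $I$, then $I = (I : b^s) \cap (I + (b^s))$ for a suitable $s$, both ideals on the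
  right are strictly larger than $I$, and the larger of their two exponents serves for $I$.

  Otherwise $R/I$ is torsion-free over $B = k[S]$, and by maximality of $S$ every other variable
  $x_i$ satisfies modulo $I$ an equation of some degree $D_i$ over $B$ with nonzero leading
  coefficient. Let $b$ be a point with coordinates indexed by $S$ at which none of these leading
  coefficients vanishes, and let $Q_b = I + (x_l - b_l : l \in S)$. Then $Q_b$ contains, for every
  variable, a nonzero polynomial in this variable alone, of degree at most some $E$ that is
  independent of $b$. For such an ideal $\Phi^{*}_e(Q_b) \subseteq Q_b$ with $e = nE + 1$
  (\<open>artinian_stabilization\<close>). Consequently $\Phi^{*}_e(I)$ is contained in all these $Q_b$.
  It remains to see that an $f$ which lies in $Q_b$ for all such $b$ outside a further
  hypersurface lies in $I$ (\<open>mem_ideal_if_mem_fibres\<close>). After inverting one element $d$ of $B$, the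
  quotient $R/I$ becomes a finite free $B$-module. The coordinates of $f$ vanish at every $b$ with
  $d(b) \neq 0$, so they are zero because $k$ is infinite; hence a power of $d$ multiplies $f$ into
  $I$, and $f \in I$ by torsion-freeness.
\<close>

section \<open>Polynomials in a given set of variables\<close>

definition polys_in :: "nat set \<Rightarrow> 'k::comm_ring_1 mpoly set"
  where "polys_in S = {p. \<forall>m\<in>Poly_Mapping.keys p. Poly_Mapping.keys m \<subseteq> S}"

lemma poly_ring_simps [simp]:
  "carrier (poly_ring n) = polys_in {..<n}"
  "x \<otimes>\<^bsub>poly_ring n\<^esub> y = x * y"
  "x \<oplus>\<^bsub>poly_ring n\<^esub> y = x + y"
  "\<one>\<^bsub>poly_ring n\<^esub> = 1"
  "\<zero>\<^bsub>poly_ring n\<^esub> = 0"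
  by (simp_all add: poly_ring_def polys_in_def)

lemma nat_pow_poly_ring [simp]: "f [^]\<^bsub>poly_ring n\<^esub> (m::nat) = f ^ m"
proof -
  interpret cring "poly_ring n :: 'a mpoly ring"
    by (rule cring_poly_ring)
  show ?thesis
    by (induct m) (simp_all add: mult.commute)
qed

lemma polys_in_add: "p \<in> polys_in S \<Longrightarrow> q \<in> polys_in S \<Longrightarrow> p + q \<in> polys_in S"
  using Poly_Mapping.keys_add[of p q] by (auto simp: polys_in_def)

lemma polys_in_uminus: "p \<in> polys_in S \<Longrightarrow> - p \<in> polys_in S"
  by (auto simp: polys_in_def)

lemma polys_in_diff: "p \<in> polys_in S \<Longrightarrow> q \<in> polys_in S \<Longrightarrow> p - q \<in> polys_in S"
  using polys_in_add[of p S "- q"] polys_in_uminus[of q S] by simp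

lemma polys_in_mult:
  assumes "p \<in> polys_in S" "q \<in> polys_in S"
  shows "p * q \<in> polys_in S"
proof -
  have "Poly_Mapping.keys m \<subseteq> S" if m: "m \<in> Poly_Mapping.keys (p * q)" for m
  proof -
    obtain a b where "a \<in> Poly_Mapping.keys p" "b \<in> Poly_Mapping.keys q" "m = a + b"
      using keys_mult[of p q] m by blast
    then show ?thesis
      using assms Poly_Mapping.keys_add[of a b] by (fastforce simp: polys_in_def)
  qed
  then show ?thesis
    by (simp add: polys_in_def)
qed

lemma polys_in_0 [simp]: "0 \<in> polys_in S" and polys_in_1 [simp]: "1 \<in> polys_in S"
  by (simp_all add: polys_in_def)

lemma polys_in_const [simp]: "const c \<in> polys_in S"
  by (simp add: const_def polys_in_def)

lemma polys_in_var: "i \<in> S \<Longrightarrow> var i \<in> polys_in S"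
  by (simp add: var_def polys_in_def)

lemma polys_in_power: "p \<in> polys_in S \<Longrightarrow> p ^ m \<in> polys_in S"
  by (induct m) (auto intro: polys_in_mult)

lemma polys_in_sum: "(\<And>x. x \<in> A \<Longrightarrow> f x \<in> polys_in S) \<Longrightarrow> sum f A \<in> polys_in S"
  by (induct A rule: infinite_finite_induct) (auto intro: polys_in_add)

lemma polys_in_prod: "(\<And>x. x \<in> A \<Longrightarrow> f x \<in> polys_in S) \<Longrightarrow> prod f A \<in> polys_in S"
  by (induct A rule: infinite_finite_induct) (auto intro: polys_in_mult)

lemma polys_in_mono: "S \<subseteq> T \<Longrightarrow> p \<in> polys_in S \<Longrightarrow> p \<in> polys_in T"
  by (auto simp: polys_in_def)

lemmas polys_in_closed = polys_in_add polys_in_uminus polys_in_diff polys_in_mult polys_in_var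
  polys_in_power polys_in_sum polys_in_prod

lemma const_0 [simp]: "const 0 = 0"
  by (simp add: const_def)

lemma const_1 [simp]: "const 1 = 1"
  by (simp add: const_def)

lemma polys_in_empty: "p \<in> polys_in {} \<Longrightarrow> p = const (Poly_Mapping.lookup p 0)"
  by (intro poly_mapping_eqI) (auto simp: polys_in_def const_def lookup_single when_def in_keys_iff)

lemma const_add: "const (a + b) = const a + const b"
  by (simp add: const_def single_add)

lemma const_uminus: "const (- a) = - const a"
  by (simp add: const_def single_uminus)

lemma const_mult: "const (a * b) = const a * const b"
  by (simp add: const_def mult_single)

lemma const_power: "const (a ^ k) = const a ^ k"
  by (induct k) (simp_all add: const_mult)

lemma const_sum: "const (sum f A) = (\<Sum>x\<in>A. const (f x))"
  by (induct A rule: infinite_finite_induct) (simp_all add: const_add)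

lemma poly_mapping_sum_single:
  fixes p :: "'a \<Rightarrow>\<^sub>0 'b::comm_monoid_add"
  shows "p = (\<Sum>m\<in>Poly_Mapping.keys p. Poly_Mapping.single m (Poly_Mapping.lookup p m))"
proof (rule poly_mapping_eqI)
  fix k
  have "(\<Sum>m\<in>Poly_Mapping.keys p. Poly_Mapping.lookup (Poly_Mapping.single m (Poly_Mapping.lookup p m)) k)
      = (\<Sum>m\<in>Poly_Mapping.keys p. if m = k then Poly_Mapping.lookup p k else 0)"
    by (intro sum.cong) (auto simp: lookup_single when_def)
  then show "Poly_Mapping.lookup p k = Poly_Mapping.lookup (\<Sum>m\<in>Poly_Mapping.keys p. Poly_Mapping.single m (Poly_Mapping.lookup p m)) k"
    by (simp add: lookup_sum in_keys_iff)
qed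

lemma poly_mapping_induct_single [case_names single add]:
  fixes p :: "'a \<Rightarrow>\<^sub>0 'b::comm_monoid_add"
  assumes "\<And>m c. P (Poly_Mapping.single m c)" "\<And>p q. P p \<Longrightarrow> P q \<Longrightarrow> P (p + q)"
  shows "P p"
proof -
  have "P (\<Sum>m\<in>A. Poly_Mapping.single m (Poly_Mapping.lookup p m))" if "finite A" for A
    using that
  proof (induct A)
    case empty
    then show ?case using assms(1)[of undefined 0] by simp
  qed (simp add: assms)
  then show ?thesis
    using poly_mapping_sum_single[of p] by (metis finite_keys)
qed

lemma var_power: "var i ^ e = Poly_Mapping.single (Poly_Mapping.single i e) 1"
  by (induct e) (simp_all add: var_def mult_single single_add[symmetric])

lemma single_factor_var:
  fixes c :: "'k::comm_ring_1" and m :: "nat \<Rightarrow>\<^sub>0 nat" and i :: nat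
  defines "m' \<equiv> m - Poly_Mapping.single i (Poly_Mapping.lookup m i)"
  shows "Poly_Mapping.single m c = Poly_Mapping.single m' c * var i ^ Poly_Mapping.lookup m i"
    and "Poly_Mapping.keys m' \<subseteq> Poly_Mapping.keys m - {i}"
proof -
  have "m = m' + Poly_Mapping.single i (Poly_Mapping.lookup m i)"
    by (rule poly_mapping_eqI) (simp add: m'_def lookup_add lookup_minus lookup_single when_def)
  then show "Poly_Mapping.single m c = Poly_Mapping.single m' c * var i ^ Poly_Mapping.lookup m i"
    by (simp add: var_power mult_single)
  show "Poly_Mapping.keys m' \<subseteq> Poly_Mapping.keys m - {i}"
    by (auto simp: m'_def in_keys_iff lookup_minus lookup_single when_def)
qed

text \<open>
  This is the decomposition $k[S, x_i] = k[S][x_i]$: the monomials of $p$ are grouped by their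
  exponent of $x_i$.
\<close>

lemma polys_in_expansion:
  fixes p :: "'k::comm_ring_1 mpoly"
  assumes p: "p \<in> polys_in (insert i S)"
  shows "\<exists>D \<gamma>. (\<forall>j. \<gamma> j \<in> polys_in S) \<and> p = (\<Sum>j\<le>D. \<gamma> j * var i ^ j)"
proof -
  let ?K = "Poly_Mapping.keys p"
  let ?deg = "\<lambda>m. Poly_Mapping.lookup m i"
  define rest where "rest m = Poly_Mapping.single (m - Poly_Mapping.single i (?deg m))
    (Poly_Mapping.lookup p m)" for m
  define D where "D = Max (insert 0 (?deg ` ?K))"
  define \<gamma> where "\<gamma> j = (\<Sum>m\<in>{m \<in> ?K. ?deg m = j}. rest m)" for j
  have rest: "Poly_Mapping.single m (Poly_Mapping.lookup p m) = rest m * var i ^ ?deg m" for m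
    unfolding rest_def by (rule single_factor_var)
  have "rest m \<in> polys_in S" if "m \<in> ?K" for m
    using p that single_factor_var(2)[of m i] by (fastforce simp: rest_def polys_in_def)
  then have "\<gamma> j \<in> polys_in S" for j
    unfolding \<gamma>_def by (intro polys_in_sum) auto
  moreover have "p = (\<Sum>j\<le>D. \<gamma> j * var i ^ j)"
  proof -
    have "p = (\<Sum>m\<in>?K. rest m * var i ^ ?deg m)"
      using poly_mapping_sum_single[of p] by (simp add: rest)
    also have "\<dots> = (\<Sum>j\<le>D. \<Sum>m\<in>{m \<in> ?K. ?deg m = j}. rest m * var i ^ ?deg m)"
      by (rule sum.group[symmetric]) (auto simp: D_def)
    also have "\<dots> = (\<Sum>j\<le>D. \<gamma> j * var i ^ j)"
      by (simp add: \<gamma>_def sum_distrib_right)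
    finally show ?thesis .
  qed
  ultimately show ?thesis
    by blast
qed

text \<open>An expansion with the least possible number of terms has a nonzero leading coefficient.\<close>

lemma polys_in_expansion_lead:
  fixes p :: "'k::comm_ring_1 mpoly"
  assumes p: "p \<in> polys_in (insert i S)" and "p \<noteq> 0"
  shows "\<exists>D \<gamma>. (\<forall>j. \<gamma> j \<in> polys_in S) \<and> p = (\<Sum>j\<le>D. \<gamma> j * var i ^ j) \<and> \<gamma> D \<noteq> 0"
proof -
  let ?P = "\<lambda>D. \<exists>\<gamma>. (\<forall>j. \<gamma> j \<in> polys_in S) \<and> p = (\<Sum>j\<le>D. \<gamma> j * var i ^ j)"
  define D where "D = (LEAST D. ?P D)"
  have ex: "\<exists>D. ?P D"
    by (rule polys_in_expansion[OF p])
  then obtain \<gamma> where \<gamma>: "\<forall>j. \<gamma> j \<in> polys_in S" "p = (\<Sum>j\<le>D. \<gamma> j * var i ^ j)"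
    using LeastI_ex[OF ex, folded D_def] by blast
  have "\<gamma> D \<noteq> 0"
  proof
    assume 0: "\<gamma> D = 0"
    then obtain D' where D': "D = Suc D'"
      using \<gamma>(2) \<open>p \<noteq> 0\<close> by (cases D) auto
    with 0 \<gamma> have "?P D'"
      by (intro exI[of _ \<gamma>]) simp
    then show False
      using Least_le[of ?P D'] D' unfolding D_def by simp
  qed
  then show ?thesis
    using \<gamma> by blast
qed

section \<open>Evaluation at a point\<close>

definition monom_value :: "(nat \<Rightarrow> 'k::comm_ring_1) \<Rightarrow> (nat \<Rightarrow>\<^sub>0 nat) \<Rightarrow> 'k"
  where "monom_value a m = (\<Prod>i\<in>Poly_Mapping.keys m. a i ^ Poly_Mapping.lookup m i)"

definition eval_at :: "(nat \<Rightarrow> 'k::comm_ring_1) \<Rightarrow> 'k mpoly \<Rightarrow> 'k"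
  where "eval_at a p = (\<Sum>m\<in>Poly_Mapping.keys p. Poly_Mapping.lookup p m * monom_value a m)"

lemma monom_value_add: "monom_value a (m + m') = monom_value a m * monom_value a m'"
proof -
  let ?K = "Poly_Mapping.keys m \<union> Poly_Mapping.keys m'"
  have ext: "monom_value a l = (\<Prod>i\<in>?K. a i ^ Poly_Mapping.lookup l i)"
    if "Poly_Mapping.keys l \<subseteq> ?K" for l
    unfolding monom_value_def by (rule prod.mono_neutral_left) (use that in \<open>auto simp: in_keys_iff\<close>)
  show ?thesis
    by (simp add: ext Poly_Mapping.keys_add lookup_add power_add prod.distrib)
qed

lemma eval_at_superset:
  assumes "finite A" "Poly_Mapping.keys p \<subseteq> A"
  shows "eval_at a p = (\<Sum>m\<in>A. Poly_Mapping.lookup p m * monom_value a m)"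
  unfolding eval_at_def by (rule sum.mono_neutral_left) (use assms in \<open>auto simp: in_keys_iff\<close>)

lemma eval_at_add [simp]: "eval_at a (p + q) = eval_at a p + eval_at a q"
proof -
  let ?K = "Poly_Mapping.keys p \<union> Poly_Mapping.keys q"
  show ?thesis
    by (simp add: eval_at_superset[of ?K] Poly_Mapping.keys_add lookup_add distrib_right sum.distrib)
qed

lemma eval_at_single: "eval_at a (Poly_Mapping.single m c) = c * monom_value a m"
  by (simp add: eval_at_superset[of "{m}"])

lemma eval_at_0 [simp]: "eval_at a 0 = 0"
  by (simp add: eval_at_def)

lemma eval_at_const [simp]: "eval_at a (const c) = c"
  by (simp add: const_def eval_at_single monom_value_def)

lemma eval_at_1 [simp]: "eval_at a 1 = 1"
  using eval_at_const[of a 1] by simp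

lemma eval_at_var [simp]: "eval_at a (var i) = a i"
  by (simp add: var_def eval_at_single monom_value_def)

lemma eval_at_mult [simp]: "eval_at a (p * q) = eval_at a p * eval_at a q"
proof (induct p rule: poly_mapping_induct_single)
  case (single m c)
  show ?case
    by (induct q rule: poly_mapping_induct_single)
      (simp_all add: mult_single eval_at_single monom_value_add algebra_simps)
qed (simp add: distrib_right)

lemma eval_at_uminus [simp]: "eval_at a (- p) = - eval_at a p"
  using eval_at_add[of a p "- p"] by (simp add: add_eq_0_iff)

lemma eval_at_diff [simp]: "eval_at a (p - q) = eval_at a p - eval_at a q"
  using eval_at_add[of a p "- q"] by simp

lemma eval_at_power [simp]: "eval_at a (p ^ k) = eval_at a p ^ k"
  by (induct k) simp_all

lemma eval_at_sum [simp]: "eval_at a (sum f A) = (\<Sum>x\<in>A. eval_at a (f x))"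
  by (induct A rule: infinite_finite_induct) simp_all

lemma eval_at_prod [simp]: "eval_at a (prod f A) = (\<Prod>x\<in>A. eval_at a (f x))"
  by (induct A rule: infinite_finite_induct) simp_all

lemma eval_at_cong:
  assumes "p \<in> polys_in S" "\<And>i. i \<in> S \<Longrightarrow> a i = b i"
  shows "eval_at a p = eval_at b p"
  unfolding eval_at_def monom_value_def
proof (intro sum.cong refl arg_cong2[where f = "(*)"] prod.cong)
  fix m i assume "m \<in> Poly_Mapping.keys p" "i \<in> Poly_Mapping.keys m"
  then have "i \<in> S"
    using assms(1) by (auto simp: polys_in_def)
  then show "a i ^ Poly_Mapping.lookup m i = b i ^ Poly_Mapping.lookup m i"
    using assms(2) by simp
qed

text \<open>Over a finite field, $1 + \prod_a (X - a)$ has no zero.\<close>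

lemma infinite_UNIV_alg_closed: "infinite (UNIV :: 'k::alg_closed_field set)"
proof
  assume fin: "finite (UNIV :: 'k set)"
  define p :: "'k poly" where "p = (\<Prod>a\<in>UNIV. [:-a, 1:]) + 1"
  have deg: "degree (\<Prod>a\<in>A. [:-a, 1:]) = card A" for A :: "'k set"
    by (subst degree_prod_sum_eq) auto
  have "card (UNIV :: 'k set) > 0"
    using fin by (simp add: card_gt_0_iff)
  then have "degree p > 0"
    unfolding p_def using deg[of UNIV] by (subst degree_add_eq_left) auto
  then obtain x where x: "poly p x = 0"
    using alg_closed_imp_poly_has_root by blast
  have "poly p x = 1"
    using fin by (simp add: p_def poly_prod)
  then show False
    using x by simp
qed

text \<open>
  By induction on the number of variables: once the coordinates in $S$ are fixed, $p$ is a
  polynomial in the remaining variable with infinitely many zeros, so the value of its leading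
  coefficient is zero, at every point.
\<close>

lemma eval_zero_imp_zero:
  fixes p :: "'k::alg_closed_field mpoly"
  assumes "finite S" "p \<in> polys_in S" "\<And>a. eval_at a p = 0"
  shows "p = 0"
  using assms
proof (induct S arbitrary: p)
  case empty
  have "p = const (Poly_Mapping.lookup p 0)"
    using empty(1) by (rule polys_in_empty)
  then show ?case
    using empty(2)[of undefined] by (metis eval_at_const const_0)
next
  case (insert i S)
  show ?case
  proof (rule ccontr)
    assume "p \<noteq> 0"
    then obtain D \<gamma> where \<gamma>: "\<And>j. \<gamma> j \<in> polys_in S" "p = (\<Sum>j\<le>D. \<gamma> j * var i ^ j)" "\<gamma> D \<noteq> 0"
      using polys_in_expansion_lead[OF insert.prems(1)] by blast
    have "eval_at a (\<gamma> D) = 0" for a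
    proof -
      let ?u = "\<Sum>j\<le>D. monom (eval_at a (\<gamma> j)) j"
      have "poly ?u t = 0" for t
      proof -
        have "eval_at (a(i := t)) (\<gamma> j) = eval_at a (\<gamma> j)" for j
          using \<gamma>(1) insert.hyps by (intro eval_at_cong) auto
        then have "poly ?u t = eval_at (a(i := t)) p"
          by (simp add: \<gamma>(2) poly_sum poly_monom)
        then show ?thesis
          using insert.prems by simp
      qed
      then have "?u = 0"
        using poly_roots_finite[of ?u] infinite_UNIV_alg_closed[where 'k = 'k] by auto
      then have "coeff ?u D = 0"
        by simp
      then show ?thesis
        by (simp add: coeff_sum)
    qed
    then have "\<gamma> D = 0"
      using insert.hyps \<gamma>(1) by blast
    then show False
      using \<gamma> by simp
  qed
qed

section \<open>Ideals of the polynomial ring\<close>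

text \<open>
  Ideals are given as subsets of a type that is itself a commutative ring. The lemmas of this section
  translate between the ring record and the operations of the type, in which all later
  calculations are done.
\<close>

lemma poly_idealI:
  fixes I :: "'k::comm_ring_1 mpoly set"
  assumes "I \<subseteq> polys_in {..<n}" "0 \<in> I" "\<And>x y. x \<in> I \<Longrightarrow> y \<in> I \<Longrightarrow> x + y \<in> I"
    and mult: "\<And>r x. r \<in> polys_in {..<n} \<Longrightarrow> x \<in> I \<Longrightarrow> r * x \<in> I"
  shows "ideal I (poly_ring n)"
proof -
  interpret cring "poly_ring n :: 'k mpoly ring"
    by (rule cring_poly_ring)
  have neg: "- x \<in> I" if "x \<in> I" for x
    using mult[of "- 1" x] that by (simp add: polys_in_uminus)
  have inv: "inv\<^bsub>add_monoid (poly_ring n)\<^esub> x = - x" if "x \<in> polys_in {..<n}" for x :: "'k mpoly"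
    using that polys_in_uminus[of x] minus_equality[of "- x" x] unfolding a_inv_def by simp
  show ?thesis
  proof (rule idealI)
    show "ring (poly_ring n :: 'k mpoly ring)"
      by (rule ring_axioms)
    show "subgroup I (add_monoid (poly_ring n))"
      unfolding subgroup_def using assms neg inv by (auto simp: subset_iff)
  next
    fix a x :: "'k mpoly" assume "a \<in> I" "x \<in> carrier (poly_ring n)"
    then have "x * a \<in> I"
      using mult by simp
    then show "x \<otimes>\<^bsub>poly_ring n\<^esub> a \<in> I" "a \<otimes>\<^bsub>poly_ring n\<^esub> x \<in> I"
      by (simp_all add: mult.commute)
  qed
qed

context
  fixes I :: "'k::comm_ring_1 mpoly set" and n :: nat
  assumes I: "ideal I (poly_ring n)"
begin

interpretation ideal I "poly_ring n"
  by (rule I)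

lemma poly_ideal_carrier: "x \<in> I \<Longrightarrow> x \<in> polys_in {..<n}"
  using Icarr by simp

lemma poly_ideal_0: "0 \<in> I"
  using additive_subgroup.zero_closed[OF additive_subgroup_axioms] by simp

lemma poly_ideal_add: "x \<in> I \<Longrightarrow> y \<in> I \<Longrightarrow> x + y \<in> I"
  using additive_subgroup.a_closed[OF additive_subgroup_axioms, of x y] by simp

lemma poly_ideal_mult: "x \<in> I \<Longrightarrow> r \<in> polys_in {..<n} \<Longrightarrow> r * x \<in> I"
  using I_l_closed[of x r] by simp

lemma poly_ideal_mult_right: "x \<in> I \<Longrightarrow> r \<in> polys_in {..<n} \<Longrightarrow> x * r \<in> I"
  using I_r_closed[of x r] by simp

lemma poly_ideal_uminus: "x \<in> I \<Longrightarrow> - x \<in> I"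
  using poly_ideal_mult[of x "- 1"] by (simp add: polys_in_uminus)

lemma poly_ideal_diff: "x \<in> I \<Longrightarrow> y \<in> I \<Longrightarrow> x - y \<in> I"
  using poly_ideal_add[of x "- y"] poly_ideal_uminus[of y] by simp

lemma poly_ideal_sum: "(\<And>x. x \<in> A \<Longrightarrow> f x \<in> I) \<Longrightarrow> sum f A \<in> I"
  by (induct A rule: infinite_finite_induct) (auto intro: poly_ideal_0 poly_ideal_add)

lemma poly_ideal_diff_mult:
  assumes "x - x' \<in> I" "y - y' \<in> I" "x \<in> polys_in {..<n}" "y' \<in> polys_in {..<n}"
  shows "x * y - x' * y' \<in> I"
proof -
  have "x * y - x' * y' = x * (y - y') + y' * (x - x')"
    by (simp add: algebra_simps)
  then show ?thesis
    using assms by (simp add: poly_ideal_add poly_ideal_mult)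
qed

lemma poly_ideal_diff_power:
  assumes "x - x' \<in> I" "x \<in> polys_in {..<n}" "x' \<in> polys_in {..<n}"
  shows "x ^ k - x' ^ k \<in> I"
  by (induct k) (use assms in \<open>auto intro: poly_ideal_0 poly_ideal_diff_mult polys_in_power\<close>)

lemma poly_ideal_one_eq: "1 \<in> I \<Longrightarrow> I = polys_in {..<n}"
  using poly_ideal_mult[of 1] poly_ideal_carrier by auto

end

lemma mem_set_add_poly_ring:
  "x \<in> I <+>\<^bsub>poly_ring n\<^esub> J \<longleftrightarrow> (\<exists>i\<in>I. \<exists>j\<in>J. x = i + j)"
  by (simp add: set_add_def' Bex_def)

lemma ideal_carrier: "ideal (polys_in {..<n} :: 'k::comm_ring_1 mpoly set) (poly_ring n)"
  by (rule poly_idealI) (auto intro: polys_in_closed)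

definition colon :: "nat \<Rightarrow> 'k::comm_ring_1 mpoly set \<Rightarrow> 'k mpoly \<Rightarrow> 'k mpoly set"
  where "colon n I h = {g \<in> polys_in {..<n}. h * g \<in> I}"

lemma ideal_colon:
  fixes I :: "'k::comm_ring_1 mpoly set"
  assumes I: "ideal I (poly_ring n)" and h: "h \<in> polys_in {..<n}"
  shows "ideal (colon n I h) (poly_ring n)"
proof (rule poly_idealI)
  fix r x :: "'k mpoly" assume "r \<in> polys_in {..<n}" "x \<in> colon n I h"
  then show "r * x \<in> colon n I h"
    using poly_ideal_mult[OF I, of "h * x" r] by (auto simp: colon_def polys_in_mult mult.left_commute)
qed (use I h in \<open>auto simp: colon_def distrib_left poly_ideal_0 intro: polys_in_add poly_ideal_add\<close>)

text \<open>
  The ideal generated by $I$ and the finite family $(h_l)_{l \in L}$, with its elements given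
  explicitly because the arguments below need the coefficients.
\<close>

definition adjoin :: "nat \<Rightarrow> 'k::comm_ring_1 mpoly set \<Rightarrow> nat set \<Rightarrow> (nat \<Rightarrow> 'k mpoly) \<Rightarrow> 'k mpoly set"
  where "adjoin n I L h =
    {i + (\<Sum>l\<in>L. g l * h l) | i g. i \<in> I \<and> (\<forall>l. g l \<in> polys_in {..<n})}"

lemma ideal_adjoin:
  fixes I :: "'k::comm_ring_1 mpoly set"
  assumes I: "ideal I (poly_ring n)" and h: "\<And>l. l \<in> L \<Longrightarrow> h l \<in> polys_in {..<n}"
  shows "ideal (adjoin n I L h) (poly_ring n)"
proof (rule poly_idealI)
  show "adjoin n I L h \<subseteq> polys_in {..<n}"
    using h poly_ideal_carrier[OF I] by (auto simp: adjoin_def intro!: polys_in_closed)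
  show "0 \<in> adjoin n I L h"
    unfolding adjoin_def using poly_ideal_0[OF I]
    by (intro CollectI exI[of _ 0] exI[of _ "\<lambda>_. 0"]) simp
next
  fix x y assume "x \<in> adjoin n I L h" "y \<in> adjoin n I L h"
  then obtain i g i' g' where "x = i + (\<Sum>l\<in>L. g l * h l)" "y = i' + (\<Sum>l\<in>L. g' l * h l)"
    "i \<in> I" "i' \<in> I" "\<forall>l. g l \<in> polys_in {..<n}" "\<forall>l. g' l \<in> polys_in {..<n}"
    unfolding adjoin_def by blast
  then show "x + y \<in> adjoin n I L h"
    unfolding adjoin_def
    by (intro CollectI exI[of _ "i + i'"] exI[of _ "\<lambda>l. g l + g' l"])
      (simp add: poly_ideal_add[OF I] polys_in_add distrib_right sum.distrib)
next
  fix r x :: "'k mpoly" assume r: "r \<in> polys_in {..<n}" and "x \<in> adjoin n I L h"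
  then obtain i g where "x = i + (\<Sum>l\<in>L. g l * h l)" "i \<in> I" "\<forall>l. g l \<in> polys_in {..<n}"
    unfolding adjoin_def by blast
  with r show "r * x \<in> adjoin n I L h"
    unfolding adjoin_def
    by (intro CollectI exI[of _ "r * i"] exI[of _ "\<lambda>l. r * g l"])
      (simp add: poly_ideal_mult[OF I] polys_in_mult distrib_left sum_distrib_left mult.assoc)
qed

lemma adjoin_superset: "I \<subseteq> adjoin n I L h"
proof
  fix x assume "x \<in> I"
  then show "x \<in> adjoin n I L h"
    unfolding adjoin_def by (intro CollectI exI[of _ x] exI[of _ "\<lambda>_. 0"]) simp
qed

lemma adjoin_gen:
  assumes "ideal I (poly_ring n)" "finite L" "l \<in> L"
  shows "h l \<in> adjoin n I L h"
  unfolding adjoin_def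
  by (intro CollectI exI[of _ 0] exI[of _ "\<lambda>j. if j = l then 1 else 0"])
    (use assms in \<open>simp add: poly_ideal_0[OF assms(1)] if_distrib[of "\<lambda>x. x * _"] sum.delta cong: if_cong\<close>)

text \<open>
  Modulo an ideal that contains $x_i - a_i$ for $i \in S$, every variable in $S$ may be replaced
  by its value. With $S$ the set of all variables this says that $\mathfrak{m}_a$ is maximal; with a
  smaller $S$ it specializes the coefficients of an equation over $k[S]$.
\<close>

lemma diff_const_eval_in_ideal:
  fixes Q :: "'k::comm_ring_1 mpoly set"
  assumes Q: "ideal Q (poly_ring n)" and "finite S" "S \<subseteq> {..<n}" "p \<in> polys_in S"
    and "\<And>i. i \<in> S \<Longrightarrow> var i - const (a i) \<in> Q"
  shows "p - const (eval_at a p) \<in> Q"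
  using assms(2-)
proof (induct S arbitrary: p)
  case empty
  then show ?case
    using polys_in_empty[of p] poly_ideal_0[OF Q] by (metis eval_at_const diff_self)
next
  case (insert i S)
  obtain D \<gamma> where \<gamma>: "\<And>j. \<gamma> j \<in> polys_in S" and p: "p = (\<Sum>j\<le>D. \<gamma> j * var i ^ j)"
    using polys_in_expansion[OF insert.prems(2)] by blast
  have R: "var i \<in> polys_in {..<n}" "\<gamma> j \<in> polys_in {..<n}" for j
    using insert.prems(1) \<gamma>[of j] by (auto intro: polys_in_var polys_in_mono[of S])
  have "\<gamma> j - const (eval_at a (\<gamma> j)) \<in> Q" for j
    using insert \<gamma>[of j] by auto
  moreover have "var i ^ j - const (a i) ^ j \<in> Q" for j
    using insert.prems(3)[of i] R by (intro poly_ideal_diff_power[OF Q]) auto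
  ultimately have "(\<Sum>j\<le>D. \<gamma> j * var i ^ j - const (eval_at a (\<gamma> j)) * const (a i) ^ j) \<in> Q"
    using R by (intro poly_ideal_sum[OF Q] poly_ideal_diff_mult[OF Q] polys_in_power) auto
  also have "(\<Sum>j\<le>D. \<gamma> j * var i ^ j - const (eval_at a (\<gamma> j)) * const (a i) ^ j)
      = p - const (eval_at a p)"
    by (simp add: p sum_subtractf const_mult const_power const_sum)
  finally show ?case .
qed

section \<open>Hilbert's basis theorem\<close>

text \<open>
  Hilbert's basis theorem is proved through leading monomials. Dickson's lemma does double duty:
  it shows that the lexicographic order on exponents of finitely many variables is well-founded,
  and it provides two polynomials along an ascending chain such that the leading monomial of the
  earlier one divides that of the later one.
\<close>

lemma nat_seq_mono_subseq:
  fixes g :: "nat \<Rightarrow> nat"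
  shows "\<exists>r::nat \<Rightarrow> nat. strict_mono r \<and> (\<forall>i j. i \<le> j \<longrightarrow> g (r i) \<le> g (r j))"
proof -
  obtain r :: "nat \<Rightarrow> nat" where r: "strict_mono r" "monoseq (\<lambda>k. g (r k))"
    using seq_monosub[of g] by blast
  from r(2) consider "\<forall>i j. i \<le> j \<longrightarrow> g (r i) \<le> g (r j)" | "\<forall>i j. i \<le> j \<longrightarrow> g (r j) \<le> g (r i)"
    unfolding monoseq_def by blast
  then show ?thesis
  proof cases
    case 1
    then show ?thesis using r by blast
  next
    case 2
    obtain N where N: "\<And>k. g (r N) \<le> g (r k)"
      using ex_has_least_nat[of "\<lambda>_. True" 0 "\<lambda>k. g (r k)"] by auto
    then have "g (r (N + k)) = g (r N)" for k
      using 2 by (simp add: antisym)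
    moreover have "strict_mono (\<lambda>k. r (N + k))"
      using r(1) by (simp add: strict_mono_def)
    ultimately show ?thesis
      by (intro exI[of _ "\<lambda>k. r (N + k)"]) simp
  qed
qed

lemma dickson_subseq:
  fixes f :: "nat \<Rightarrow> 'a \<Rightarrow> nat"
  assumes "finite S"
  shows "\<exists>r::nat \<Rightarrow> nat. strict_mono r \<and> (\<forall>x\<in>S. \<forall>i j. i \<le> j \<longrightarrow> f (r i) x \<le> f (r j) x)"
  using assms
proof induct
  case empty
  show ?case
    by (intro exI[of _ id]) (simp add: strict_mono_def)
next
  case (insert x S)
  then obtain r :: "nat \<Rightarrow> nat" where r: "strict_mono r" "\<forall>x\<in>S. \<forall>i j. i \<le> j \<longrightarrow> f (r i) x \<le> f (r j) x"
    by blast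
  obtain s :: "nat \<Rightarrow> nat" where s: "strict_mono s" "\<forall>i j. i \<le> j \<longrightarrow> f (r (s i)) x \<le> f (r (s j)) x"
    using nat_seq_mono_subseq[of "\<lambda>k. f (r k) x"] by blast
  have "strict_mono (r \<circ> s)"
    using r(1) s(1) by (rule strict_mono_o)
  moreover have "s i \<le> s j" if "i \<le> j" for i j
    using s(1) that by (simp add: strict_mono_less_eq)
  ultimately show ?case
    using r(2) s(2) by (intro exI[of _ "r \<circ> s"]) (simp add: comp_def)
qed

lemma dickson:
  fixes f :: "nat \<Rightarrow> nat \<Rightarrow>\<^sub>0 nat"
  assumes "finite S" "\<And>k. Poly_Mapping.keys (f k) \<subseteq> S"
  obtains i j t where "i < j" "f j = t + f i"
proof -
  obtain r :: "nat \<Rightarrow> nat" where r: "strict_mono r"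
    "\<forall>x\<in>S. \<forall>i j. i \<le> j \<longrightarrow> Poly_Mapping.lookup (f (r i)) x \<le> Poly_Mapping.lookup (f (r j)) x"
    using dickson_subseq[OF assms(1), of "\<lambda>k. Poly_Mapping.lookup (f k)"] by blast
  have "Poly_Mapping.lookup (f (r 0)) x \<le> Poly_Mapping.lookup (f (r 1)) x" for x
  proof (cases "x \<in> S")
    case False
    then have "x \<notin> Poly_Mapping.keys (f (r 0))"
      using assms(2) by blast
    then show ?thesis
      by (simp add: in_keys_iff)
  qed (use r in auto)
  then have "f (r 1) = (f (r 1) - f (r 0)) + f (r 0)"
    by (intro poly_mapping_eqI) (simp add: lookup_add lookup_minus)
  moreover have "r 0 < r 1"
    using r(1) by (simp add: strict_mono_less)
  ultimately show ?thesis
    using that by blast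
qed

text \<open>
  In the lexicographic order of finitely supported functions 0 is the least exponent, because no
  entry is negative.
\<close>

lemma exponent_le_add: "(m :: nat \<Rightarrow>\<^sub>0 nat) \<le> t + m"
proof -
  have "0 \<le> t"
  proof (rule ccontr)
    assume "\<not> 0 \<le> t"
    then have "t < 0" by simp
    then show False
      by (transfer) (auto simp: less_fun_def)
  qed
  then show ?thesis
    using add_right_mono[of 0 t m] by simp
qed

lemma wf_exponents:
  assumes "finite S"
  shows "wf {(m, m' :: nat \<Rightarrow>\<^sub>0 nat). m < m' \<and> Poly_Mapping.keys m \<subseteq> S \<and> Poly_Mapping.keys m' \<subseteq> S}"
  unfolding wf_iff_no_infinite_down_chain
proof
  assume "\<exists>f. \<forall>i. (f (Suc i), f i) \<in> {(m, m' :: nat \<Rightarrow>\<^sub>0 nat).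
    m < m' \<and> Poly_Mapping.keys m \<subseteq> S \<and> Poly_Mapping.keys m' \<subseteq> S}"
  then obtain f :: "nat \<Rightarrow> nat \<Rightarrow>\<^sub>0 nat"
    where f: "\<And>i. f (Suc i) < f i" "\<And>i. Poly_Mapping.keys (f i) \<subseteq> S"
    by auto
  obtain i j t where "i < j" "f j = t + f i"
    by (rule dickson[OF assms f(2)])
  moreover have "f j < f i"
    using \<open>i < j\<close> f(1) by (induct j) (auto simp: less_Suc_eq intro: less_trans)
  ultimately show False
    using exponent_le_add[of "f i" t] by simp
qed

lemma lookup_single_times:
  fixes f :: "'k::comm_ring_1 mpoly"
  shows "Poly_Mapping.lookup (Poly_Mapping.single t c * f) (t + m) = c * Poly_Mapping.lookup f m"
  by (induct f rule: poly_mapping_induct_single)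
    (auto simp: mult_single lookup_single when_def distrib_left lookup_add)

definition lead :: "'k::zero mpoly \<Rightarrow> (nat \<Rightarrow>\<^sub>0 nat)"
  where "lead p = Max (Poly_Mapping.keys p)"

lemma lead_in_keys: "p \<noteq> 0 \<Longrightarrow> lead p \<in> Poly_Mapping.keys p"
  unfolding lead_def by (rule Max_in) simp_all

lemma le_lead: "m \<in> Poly_Mapping.keys p \<Longrightarrow> m \<le> lead p"
  unfolding lead_def by (rule Max_ge) simp_all

text \<open>One step of polynomial division: a multiple of $f$ cancels the leading term of $g$.\<close>

lemma lead_cancel:
  fixes f g :: "'k::field mpoly"
  assumes "f \<noteq> 0" "g \<noteq> 0" "lead g = t + lead f"
  obtains c where "g - Poly_Mapping.single t c * f \<noteq> 0 \<Longrightarrow> lead (g - Poly_Mapping.single t c * f) < lead g"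
proof -
  define c where "c = Poly_Mapping.lookup g (lead g) / Poly_Mapping.lookup f (lead f)"
  define h where "h = g - Poly_Mapping.single t c * f"
  have "Poly_Mapping.lookup f (lead f) \<noteq> 0"
    using lead_in_keys[OF assms(1)] by (simp add: in_keys_iff)
  then have "Poly_Mapping.lookup h (lead g) = 0"
    by (simp add: h_def lookup_minus assms(3) lookup_single_times) (simp add: c_def assms(3))
  moreover have "m \<le> lead g" if m: "m \<in> Poly_Mapping.keys h" for m
  proof -
    have "m \<in> Poly_Mapping.keys g \<or> m \<in> Poly_Mapping.keys (Poly_Mapping.single t c * f)"
      using m keys_diff[of g "Poly_Mapping.single t c * f"] unfolding h_def by auto
    then show ?thesis
    proof
      assume "m \<in> Poly_Mapping.keys (Poly_Mapping.single t c * f)"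
      then obtain k where "m = t + k" "k \<in> Poly_Mapping.keys f"
        using keys_mult[of "Poly_Mapping.single t c" f] by (auto split: if_splits)
      then show ?thesis
        using add_left_mono[OF le_lead, of k f t] by (simp add: assms(3))
    qed (rule le_lead)
  qed
  ultimately have "h \<noteq> 0 \<Longrightarrow> lead h < lead g"
    using lead_in_keys[of h] by (metis in_keys_iff order_le_imp_less_or_eq)
  then show ?thesis
    using that unfolding h_def by blast
qed

text \<open>
  In a strictly ascending chain choose $f_i \in I_{i+1} \setminus I_i$ with least possible leading
  monomial. Some leading monomial of $f_i$ divides that of $f_j$ with $i < j$; reducing $f_j$ by
  $f_i \in I_j$ keeps it in $I_{j+1} \setminus I_j$ and lowers its leading monomial, a contradiction.
\<close>

theorem noetherian_poly_ring:
  "wf {(J, K :: 'k::field mpoly set). ideal J (poly_ring n) \<and> ideal K (poly_ring n) \<and> K \<subset> J}"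
  unfolding wf_iff_no_infinite_down_chain
proof
  assume "\<exists>I. \<forall>i. (I (Suc i), I i) \<in>
    {(J, K :: 'k mpoly set). ideal J (poly_ring n) \<and> ideal K (poly_ring n) \<and> K \<subset> J}"
  then obtain I :: "nat \<Rightarrow> 'k mpoly set"
    where "\<forall>i. ideal (I (Suc i)) (poly_ring n) \<and> ideal (I i) (poly_ring n) \<and> I i \<subset> I (Suc i)"
    by auto
  then have I: "\<And>i. ideal (I i) (poly_ring n)" "\<And>i. I i \<subset> I (Suc i)"
    by blast+
  have mono: "I i \<subseteq> I j" if "i \<le> j" for i j
    by (rule lift_Suc_mono_le[of I, OF psubset_imp_subset[OF I(2)] that])
  let ?r = "{(m, m' :: nat \<Rightarrow>\<^sub>0 nat). m < m' \<and> Poly_Mapping.keys m \<subseteq> {..<n} \<and> Poly_Mapping.keys m' \<subseteq> {..<n}}"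
  have keys: "Poly_Mapping.keys (lead p) \<subseteq> {..<n}" if "p \<in> I i" "p \<noteq> 0" for p i
    using poly_ideal_carrier[OF I(1) that(1)] lead_in_keys[OF that(2)] by (auto simp: polys_in_def)
  have "\<exists>f. f \<in> I (Suc i) - I i \<and> (\<forall>g\<in>I (Suc i) - I i. \<not> lead g < lead f)" for i
  proof -
    let ?X = "I (Suc i) - I i"
    obtain g0 where "g0 \<in> ?X"
      using I(2)[of i] by auto
    then have "\<exists>m\<in>lead ` ?X. \<forall>m'. (m', m) \<in> ?r \<longrightarrow> m' \<notin> lead ` ?X"
      by (intro wf_exponents[of "{..<n}", unfolded wf_eq_minimal, rule_format, of "lead g0"]) auto
    then obtain f where f: "f \<in> ?X" "\<And>g. g \<in> ?X \<Longrightarrow> (lead g, lead f) \<notin> ?r"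
      by blast
    moreover have "Poly_Mapping.keys (lead g) \<subseteq> {..<n}" if "g \<in> ?X" for g
      using that poly_ideal_0[OF I(1)[of i]] by (intro keys[of _ "Suc i"]) auto
    ultimately show ?thesis
      by blast
  qed
  then obtain f where f: "\<And>i. f i \<in> I (Suc i)" "\<And>i. f i \<notin> I i"
    and min: "\<And>i g. g \<in> I (Suc i) \<Longrightarrow> g \<notin> I i \<Longrightarrow> \<not> lead g < lead (f i)"
    by (metis DiffE DiffI)
  have nz: "f i \<noteq> 0" for i
    using f(2)[of i] poly_ideal_0[OF I(1)[of i]] by auto
  obtain i j t where ij: "i < j" "lead (f j) = t + lead (f i)"
    by (rule dickson[OF _ keys[OF f(1) nz]]) auto
  obtain c where c: "f j - Poly_Mapping.single t c * f i \<noteq> 0 \<Longrightarrow>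
      lead (f j - Poly_Mapping.single t c * f i) < lead (f j)"
    using lead_cancel[OF nz nz ij(2)] by blast
  have "Poly_Mapping.keys t \<subseteq> Poly_Mapping.keys (lead (f j))"
    unfolding ij(2) by (auto simp: in_keys_iff lookup_add)
  then have "Poly_Mapping.single t c \<in> polys_in {..<n}"
    using keys[OF f(1) nz, of j] by (auto simp: polys_in_def)
  then have s: "Poly_Mapping.single t c * f i \<in> I j"
    using poly_ideal_mult[OF I(1) f(1)] mono[of "Suc i" j] ij(1) by auto
  then have "f j - Poly_Mapping.single t c * f i \<in> I (Suc j)"
    using poly_ideal_diff[OF I(1) f(1)] mono[of j "Suc j"] by auto
  moreover have "f j - Poly_Mapping.single t c * f i \<notin> I j"
    using poly_ideal_add[OF I(1) _ s, of "f j - Poly_Mapping.single t c * f i"] f(2)[of j] by auto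
  ultimately show False
    using min c poly_ideal_0[OF I(1)[of j]] by metis
qed

section \<open>Powers of the ideal of a point\<close>

abbreviation point_power :: "nat \<Rightarrow> (nat \<Rightarrow> 'k::comm_ring_1) \<Rightarrow> nat \<Rightarrow> 'k mpoly set"
  where "point_power n a q \<equiv> point_ideal n a [^]\<^bsub>ideals_set (poly_ring n)\<^esub> q"

lemma point_power_0: "point_power n a 0 = polys_in {..<n}"
  by (simp add: nat_pow_def ideals_set_def)

lemma point_power_Suc:
  "point_power n a (Suc q) = ideal_prod (poly_ring n) (point_power n a q) (point_ideal n a)"
  by (simp add: nat_pow_def ideals_set_def)

lemma ideal_point_power: "ideal (point_power n a q) (poly_ring n)"
proof -
  interpret cring "poly_ring n :: 'a mpoly ring"
    by (rule cring_poly_ring)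
  show ?thesis
  proof (induct q)
    case 0
    show ?case
      by (simp only: point_power_0 ideal_carrier)
  next
    case (Suc q)
    then show ?case
      by (simp only: point_power_Suc ideal_prod_is_ideal ideal_point_ideal)
  qed
qed

lemma point_power_Suc_subset: "point_power n a (Suc q) \<subseteq> point_power n a q"
proof -
  interpret cring "poly_ring n :: 'a mpoly ring"
    by (rule cring_poly_ring)
  show ?thesis
    using ideal_prod_inter[OF ideal_point_power[of n a q] ideal_point_ideal[of n a]]
    by (simp only: point_power_Suc) blast
qed

lemma point_power_1: "point_power n a (Suc 0) = point_ideal n a"
proof -
  interpret cring "poly_ring n :: 'a mpoly ring"
    by (rule cring_poly_ring)
  show ?thesis
    unfolding point_power_Suc point_power_0
    using ideal_prod_one[OF ideal_point_ideal[of n a]]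
      ideal_prod_commute[OF ideal_point_ideal[of n a] ideal_carrier] by simp
qed

lemma power_in_point_power:
  assumes "x \<in> point_ideal n a"
  shows "x ^ q \<in> point_power n a q"
proof (induct q)
  case 0
  show ?case
    by (simp only: point_power_0) simp
next
  case (Suc q)
  then show ?case
    using ideal_prod.prod[of "x ^ q" "point_power n a q" x "point_ideal n a" "poly_ring n"] assms
    by (simp only: point_power_Suc) (simp add: mult.commute)
qed

lemma gen_in_point_ideal:
  assumes "i < n"
  shows "var i - const (a i) \<in> point_ideal n a"
proof -
  interpret cring "poly_ring n :: 'a mpoly ring"
    by (rule cring_poly_ring)
  have "(\<lambda>i. var i - const (a i)) ` {..<n} \<subseteq> carrier (poly_ring n)"
    by (auto intro!: polys_in_closed)
  from genideal_self[OF this] show ?thesis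
    unfolding point_ideal_def using assms by blast
qed

lemma point_ideal_minimal:
  assumes "ideal Q (poly_ring n)" "\<And>i. i < n \<Longrightarrow> var i - const (a i) \<in> Q"
  shows "point_ideal n a \<subseteq> Q"
proof -
  interpret cring "poly_ring n :: 'a mpoly ring"
    by (rule cring_poly_ring)
  show ?thesis
    unfolding point_ideal_def using assms by (intro genideal_minimal) auto
qed

text \<open>
  A membership test for $\mathfrak{m}_a^{q+1}$ that looks only at products of one generator with an
  element of $\mathfrak{m}_a^q$: the elements that multiply $h$ into $Q$ form an ideal, which
  contains $\mathfrak{m}_a$ as soon as it contains its generators.
\<close>

lemma point_power_Suc_minimal:
  fixes Q :: "'k::comm_ring_1 mpoly set"
  assumes Q: "ideal Q (poly_ring n)"
    and gen: "\<And>i h. i < n \<Longrightarrow> h \<in> point_power n a q \<Longrightarrow> (var i - const (a i)) * h \<in> Q"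
  shows "point_power n a (Suc q) \<subseteq> Q"
proof
  fix x assume "x \<in> point_power n a (Suc q)"
  then have "x \<in> ideal_prod (poly_ring n) (point_power n a q) (point_ideal n a)"
    by (simp only: point_power_Suc)
  then show "x \<in> Q"
  proof induct
    case (prod h g)
    have h: "h \<in> polys_in {..<n}"
      using poly_ideal_carrier[OF ideal_point_power prod(1)] .
    have "point_ideal n a \<subseteq> colon n Q h"
      using prod(1) gen h
      by (intro point_ideal_minimal ideal_colon Q)
        (auto simp: colon_def mult.commute intro!: polys_in_closed)
    then show ?case
      using prod(2) by (auto simp: colon_def)
  qed (simp add: poly_ideal_add[OF Q])
qed

text \<open>
  A monomial of degree greater than $\sum_i d_i$ in the $x_i - a_i$ contains one of the factors
  $(x_i - a_i)^{d_i}$. Instead of expanding into monomials, the induction splits off one generator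
  $x_i - a_i$ at a time and passes to the colon ideal, for which $d_i$ drops by one. The summand 1 in
  the exponent also covers $n = 0$, where $\mathfrak{m}_a = 0$ but $\mathfrak{m}_a^0 = R$.
\<close>

lemma point_power_subset:
  fixes Q :: "'k::comm_ring_1 mpoly set"
  assumes "ideal Q (poly_ring n)" "\<And>i. i < n \<Longrightarrow> (var i - const (a i)) ^ d i \<in> Q"
  shows "point_power n a (Suc (\<Sum>i<n. d i)) \<subseteq> Q"
  using assms
proof (induct "\<Sum>i<n. d i" arbitrary: Q d rule: less_induct)
  case less
  show ?case
  proof (rule point_power_Suc_minimal[OF less.prems(1)])
    fix i h assume i: "i < n" and h: "h \<in> point_power n a (\<Sum>i<n. d i)"
    let ?y = "\<lambda>i. var i - const (a i)"
    have y: "?y i \<in> polys_in {..<n}" if "i < n" for i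
      using that by (auto intro!: polys_in_closed)
    have hR: "h \<in> polys_in {..<n}"
      using poly_ideal_carrier[OF ideal_point_power h] .
    show "?y i * h \<in> Q"
    proof (cases "d i = 0")
      case True
      then have "1 \<in> Q"
        using less.prems(2)[OF i] by simp
      then show ?thesis
        using poly_ideal_one_eq[OF less.prems(1)] y[OF i] hR by (auto intro: polys_in_mult)
    next
      case False
      define d' where "d' = d(i := d i - 1)"
      have "(\<Sum>j<n. d j) = d i + (\<Sum>j\<in>{..<n} - {i}. d j)"
        using i by (subst sum.remove[of _ i]) auto
      moreover have "(\<Sum>j<n. d' j) = d' i + (\<Sum>j\<in>{..<n} - {i}. d' j)"
        using i by (subst sum.remove[of _ i]) auto
      moreover have "(\<Sum>j\<in>{..<n} - {i}. d' j) = (\<Sum>j\<in>{..<n} - {i}. d j)"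
        by (intro sum.cong) (auto simp: d'_def)
      ultimately have sum: "(\<Sum>j<n. d j) = Suc (\<Sum>j<n. d' j)"
        using False by (simp add: d'_def)
      have "?y j ^ d' j \<in> colon n Q (?y i)" if j: "j < n" for j
      proof (cases "j = i")
        case True
        then have "?y i * ?y j ^ d' j = ?y i ^ d i"
          using False by (simp add: d'_def power_eq_if)
        then show ?thesis
          using less.prems(2)[OF i] y[OF j] by (auto simp: colon_def intro!: polys_in_power)
      next
        case False
        then show ?thesis
          using less.prems(2)[OF j] y[OF j] y[OF i]
          by (auto simp: colon_def d'_def intro!: polys_in_power poly_ideal_mult[OF less.prems(1)])
      qed
      then have "point_power n a (Suc (\<Sum>j<n. d' j)) \<subseteq> colon n Q (?y i)"
        using sum y[OF i] by (intro less.hyps ideal_colon less.prems(1)) auto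
      then show ?thesis
        using h sum by (auto simp: colon_def)
    qed
  qed
qed

section \<open>The operators $\Phi^{*}_q$\<close>

lemma set_add_poly_ring_mono:
  "I \<subseteq> I' \<Longrightarrow> J \<subseteq> J' \<Longrightarrow> I <+>\<^bsub>poly_ring n\<^esub> J \<subseteq> I' <+>\<^bsub>poly_ring n\<^esub> J'"
  unfolding subset_iff mem_set_add_poly_ring by blast

lemma Phi_star_mono: "J \<subseteq> K \<Longrightarrow> Phi_star n q J \<subseteq> Phi_star n q K"
  unfolding Phi_star_def by (intro INF_mono' set_add_poly_ring_mono order_refl)

text \<open>
  Points of affine space are functions with a default value outside the first $n$ indices, whereas
  evaluation is defined for all functions.
\<close>

lemma restrict_in_affine_space: "restrict a {..<n} \<in> affine_space n"
  by (simp add: affine_space_def)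

lemma Phi_star_carrier:
  assumes "ideal I (poly_ring n)"
  shows "Phi_star n q I \<subseteq> polys_in {..<n}"
proof
  fix x assume "x \<in> Phi_star n q I"
  then have "x \<in> I <+>\<^bsub>poly_ring n\<^esub> point_power n (restrict undefined {..<n}) q"
    using restrict_in_affine_space unfolding Phi_star_def by blast
  then show "x \<in> polys_in {..<n}"
    unfolding mem_set_add_poly_ring
    using poly_ideal_carrier[OF assms] poly_ideal_carrier[OF ideal_point_power]
    by (blast intro: polys_in_add)
qed

lemma subset_Phi_star: "I \<subseteq> Phi_star n q I"
proof -
  have "x \<in> I <+>\<^bsub>poly_ring n\<^esub> point_power n a q" if "x \<in> I" for x a
    unfolding mem_set_add_poly_ring
    using that by (intro bexI[of _ x] bexI[of _ 0] poly_ideal_0[OF ideal_point_power]) auto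
  then show ?thesis
    unfolding Phi_star_def by blast
qed

lemma Phi_star_Suc_subset: "Phi_star n (Suc q) I \<subseteq> Phi_star n q I"
  unfolding Phi_star_def
  by (intro INF_mono' set_add_poly_ring_mono order_refl point_power_Suc_subset)

lemma Phi_star_antimono: "q \<le> r \<Longrightarrow> Phi_star n r I \<subseteq> Phi_star n q I"
  by (rule lift_Suc_antimono_le[of "\<lambda>q. Phi_star n q I"]) (rule Phi_star_Suc_subset)

section \<open>Polynomials in a single variable\<close>

definition upoly :: "nat \<Rightarrow> 'k::comm_ring_1 poly \<Rightarrow> 'k mpoly"
  where "upoly i u = poly (map_poly const u) (var i)"

lemma upoly_pCons: "upoly i (pCons a u) = const a + var i * upoly i u"
  by (simp add: upoly_def map_poly_pCons)

lemma upoly_0 [simp]: "upoly i 0 = 0"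
  by (simp add: upoly_def)

lemma upoly_add: "upoly i (u + v) = upoly i u + upoly i v"
proof -
  have "map_poly const (u + v) = map_poly const u + map_poly const v"
    by (intro poly_eqI) (simp add: coeff_map_poly const_add)
  then show ?thesis
    by (simp add: upoly_def)
qed

lemma upoly_smult: "upoly i (smult c u) = const c * upoly i u"
  by (induct u) (simp_all add: upoly_pCons const_mult algebra_simps)

lemma upoly_mult: "upoly i (u * v) = upoly i u * upoly i v"
  by (induct u) (simp_all add: upoly_pCons upoly_add upoly_smult algebra_simps)

lemma upoly_power: "upoly i (u ^ k) = upoly i u ^ k"
  by (induct k) (simp_all add: upoly_mult one_pCons upoly_pCons)

lemma upoly_linear: "upoly i [:- c, 1:] = var i - const c"
  by (simp add: upoly_pCons const_uminus)

lemma upoly_monom: "upoly i (monom c k) = const c * var i ^ k"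
  by (simp add: upoly_def map_poly_monom poly_monom)

lemma upoly_sum: "upoly i (sum f A) = (\<Sum>x\<in>A. upoly i (f x))"
  by (induct A rule: infinite_finite_induct) (simp_all add: upoly_add)

lemma upoly_in_polys_in: "i \<in> S \<Longrightarrow> upoly i u \<in> polys_in S"
  by (induct u) (auto simp: upoly_pCons intro!: polys_in_closed)

lemma eval_at_upoly [simp]: "eval_at a (upoly i u) = poly u (a i)"
  by (induct u) (simp_all add: upoly_pCons)

section \<open>Zero-dimensional ideals\<close>

lemma ex_maximal_ideal_in:
  fixes K :: "'k::field mpoly set"
  assumes "\<And>J. J \<in> F \<Longrightarrow> ideal J (poly_ring n)" "K \<in> F"
  shows "\<exists>M\<in>F. \<forall>J\<in>F. \<not> M \<subset> J"
proof -
  have "\<exists>M\<in>F. \<forall>J. (J, M) \<in> {(J, K :: 'k mpoly set).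
      ideal J (poly_ring n) \<and> ideal K (poly_ring n) \<and> K \<subset> J} \<longrightarrow> J \<notin> F"
    using assms(2) by (rule noetherian_poly_ring[unfolded wf_eq_minimal, rule_format])
  then obtain M where M: "M \<in> F"
    and min: "\<And>J. ideal J (poly_ring n) \<Longrightarrow> ideal M (poly_ring n) \<Longrightarrow> M \<subset> J \<Longrightarrow> J \<notin> F"
    by auto
  have "\<not> M \<subset> J" if "J \<in> F" for J
    using min[OF assms(1)[OF that] assms(1)[OF M]] that by auto
  then show ?thesis
    using M by blast
qed

text \<open>
  Over an algebraically closed field $u$ splits into linear factors. A linear factor that does
  not lie in $M$ is a unit modulo $M$ and can be divided out, and not all of them can be
  divided out since $M$ contains no nonzero constant.
\<close>

lemma linear_factor_in_maximal_ideal: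
  fixes M :: "'k::alg_closed_field mpoly set"
  assumes M: "ideal M (poly_ring n)" "1 \<notin> M"
    and max: "\<And>J. ideal J (poly_ring n) \<Longrightarrow> M \<subset> J \<Longrightarrow> 1 \<in> J"
    and i: "i < n" and u: "u \<noteq> 0" "upoly i u \<in> M"
  shows "\<exists>c. var i - const c \<in> M"
  using u
proof (induct "degree u" arbitrary: u rule: less_induct)
  case less
  show ?case
  proof (cases "degree u = 0")
    case True
    then obtain c where c: "u = [:c:]"
      by (rule degree_eq_zeroE)
    have "const (1 / c) * upoly i u \<in> M"
      using less.prems(2) by (intro poly_ideal_mult[OF M(1)]) auto
    moreover have "const (1 / c) * upoly i u = 1"
      using less.prems(1) by (simp add: c upoly_pCons flip: const_mult)
    ultimately show ?thesis
      using M(2) by simp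
  next
    case False
    then obtain c where "poly u c = 0"
      using alg_closed_imp_poly_has_root by blast
    then obtain v where v: "u = [:- c, 1:] * v"
      by (metis poly_eq_0_iff_dvd dvdE)
    let ?y = "var i - const c"
    have uv: "upoly i u = ?y * upoly i v"
      by (simp only: v upoly_mult upoly_linear)
    have y: "?y \<in> polys_in {..<n}" "upoly i v \<in> polys_in {..<n}"
      using i by (auto intro!: polys_in_closed upoly_in_polys_in)
    show ?thesis
    proof (cases "?y \<in> M")
      case False
      let ?J = "adjoin n M {0} (\<lambda>_. ?y)"
      have "ideal ?J (poly_ring n)"
        using y by (intro ideal_adjoin[OF M(1)])
      moreover have "M \<subset> ?J"
        using adjoin_superset[of M n "{0}" "\<lambda>_. ?y"] adjoin_gen[OF M(1), of "{0}" 0 "\<lambda>_. ?y"] False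
        by auto
      ultimately have "1 \<in> ?J"
        by (rule max)
      then obtain m g where mg: "m \<in> M" "g \<in> polys_in {..<n}" "1 = m + g * ?y"
        by (auto simp: adjoin_def)
      have "upoly i v = (m + g * ?y) * upoly i v"
        by (simp flip: mg(3))
      also have "\<dots> = m * upoly i v + g * upoly i u"
        by (simp add: uv algebra_simps)
      also have "\<dots> \<in> M"
        using mg y less.prems(2)
        by (intro poly_ideal_add[OF M(1)] poly_ideal_mult[OF M(1)] poly_ideal_mult_right[OF M(1)])
      finally have "upoly i v \<in> M" .
      moreover have "v \<noteq> 0" "degree v < degree u"
        using less.prems(1) by (auto simp: v degree_mult_eq simp del: mult_pCons_left)
      ultimately show ?thesis
        using less.hyps by blast
    qed blast
  qed
qed

text \<open>
  The elementary case of the Nullstellensatz: a maximal ideal above $K$ contains some $x_i - a_i$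
  for every $i$, so every $g \in K$ is congruent to the constant $g(a)$ modulo this proper ideal.
\<close>

lemma common_zero:
  fixes K :: "'k::alg_closed_field mpoly set"
  assumes K: "ideal K (poly_ring n)" "1 \<notin> K"
    and u: "\<And>i. i < n \<Longrightarrow> u i \<noteq> 0" "\<And>i. i < n \<Longrightarrow> upoly i (u i) \<in> K"
  shows "\<exists>a\<in>affine_space n. \<forall>g\<in>K. eval_at a g = 0"
proof -
  let ?F = "{J. ideal J (poly_ring n) \<and> K \<subseteq> J \<and> 1 \<notin> J}"
  have "\<exists>M\<in>?F. \<forall>J\<in>?F. \<not> M \<subset> J"
    by (rule ex_maximal_ideal_in[of _ n K]) (use K in auto)
  then obtain M where M: "ideal M (poly_ring n)" "K \<subseteq> M" "1 \<notin> M"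
    and no_larger: "\<forall>J\<in>?F. \<not> M \<subset> J"
    by auto
  have max: "1 \<in> J" if J: "ideal J (poly_ring n)" "M \<subset> J" for J
  proof (rule ccontr)
    assume "1 \<notin> J"
    then have "J \<in> ?F"
      using J M(2) by auto
    then show False
      using no_larger J(2) by simp
  qed
  have "\<exists>c. var i - const c \<in> M" if "i < n" for i
    using linear_factor_in_maximal_ideal[OF M(1,3) max that u(1)[OF that]] u(2)[OF that] M(2)
    by blast
  then obtain b where b: "\<And>i. i < n \<Longrightarrow> var i - const (b i) \<in> M"
    by metis
  define a where "a = restrict b {..<n}"
  show ?thesis
  proof (intro bexI ballI)
    show "a \<in> affine_space n"
      unfolding a_def by (rule restrict_in_affine_space)
  next
    fix g assume "g \<in> K"
    then have g: "g \<in> M" "g \<in> polys_in {..<n}"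
      using M(2) poly_ideal_carrier[OF K(1)] by auto
    have "g - const (eval_at a g) \<in> M"
      using b by (intro diff_const_eval_in_ideal[OF M(1) _ _ g(2)]) (auto simp: a_def)
    then have "g - (g - const (eval_at a g)) \<in> M"
      by (rule poly_ideal_diff[OF M(1) g(1)])
    then have "const (1 / eval_at a g) * const (eval_at a g) \<in> M"
      by (intro poly_ideal_mult[OF M(1)]) auto
    then show "eval_at a g = 0"
      using M(3) by (cases "eval_at a g = 0") (auto simp flip: const_mult)
  qed
qed

text \<open>
  The exponent depends only on the degrees of the univariate polynomials, which makes it uniform
  over all fibres later on. For the proof, suppose that $f \notin Q$. Then the proper ideal
  $(Q : f)$ has a common zero $a$. Write $u_i = (X - a_i)^{o_i} r_i$ with $r_i(a_i) \neq 0$ and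
  put $\rho = \prod_i r_i(x_i)$. Since $o_i \le D$, multiplication by $\rho$ takes every
  $(x_i - a_i)^D$ and therefore $\mathfrak{m}_a^{nD+1}$ into $Q$. As
  $f \in Q + \mathfrak{m}_a^{nD+1}$, this puts $\rho$ into $(Q : f)$, although $\rho(a) \neq 0$.
\<close>

lemma artinian_stabilization:
  fixes Q :: "'k::alg_closed_field mpoly set"
  assumes Q: "ideal Q (poly_ring n)"
    and u: "\<And>i. i < n \<Longrightarrow> u i \<noteq> 0" "\<And>i. i < n \<Longrightarrow> upoly i (u i) \<in> Q"
    and deg: "\<And>i. i < n \<Longrightarrow> degree (u i) \<le> D"
  shows "Phi_star n (Suc (n * D)) Q \<subseteq> Q"
proof
  fix f assume f: "f \<in> Phi_star n (Suc (n * D)) Q"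
  have split: "\<exists>j\<in>Q. \<exists>h\<in>point_power n a (Suc (n * D)). f = j + h" if "a \<in> affine_space n" for a
    using f that by (simp add: Phi_star_def mem_set_add_poly_ring)
  have fR: "f \<in> polys_in {..<n}"
    using f Phi_star_carrier[OF Q] by blast
  have K: "ideal (colon n Q f) (poly_ring n)"
    by (rule ideal_colon[OF Q fR])
  show "f \<in> Q"
  proof (rule ccontr)
    assume "f \<notin> Q"
    then have one: "1 \<notin> colon n Q f"
      by (simp add: colon_def)
    have up: "upoly i (u i) \<in> colon n Q f" if "i < n" for i
      using u(2)[OF that] fR that
      by (auto simp: colon_def intro!: upoly_in_polys_in poly_ideal_mult[OF Q])
    obtain a where a: "a \<in> affine_space n" "\<And>g. g \<in> colon n Q f \<Longrightarrow> eval_at a g = 0"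
      using common_zero[OF K one u(1) up] by blast
    have "\<exists>r. u i = [:- a i, 1:] ^ Polynomial.order (a i) (u i) * r \<and> poly r (a i) \<noteq> 0" if "i < n" for i
      using Polynomial.order_decomp[OF u(1)[OF that], of "a i"] by (auto simp: poly_eq_0_iff_dvd)
    then obtain r where r: "\<And>i. i < n \<Longrightarrow> u i = [:- a i, 1:] ^ Polynomial.order (a i) (u i) * r i"
      "\<And>i. i < n \<Longrightarrow> poly (r i) (a i) \<noteq> 0"
      by metis
    define \<rho> where "\<rho> = (\<Prod>i<n. upoly i (r i))"
    have \<rho>R: "\<rho> \<in> polys_in {..<n}"
      unfolding \<rho>_def by (intro polys_in_prod upoly_in_polys_in) auto
    have "(var i - const (a i)) ^ D \<in> colon n Q \<rho>" if i: "i < n" for i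
    proof -
      let ?y = "var i - const (a i)" and ?o = "Polynomial.order (a i) (u i)"
      let ?rest = "\<Prod>l\<in>{..<n} - {i}. upoly l (r l)"
      have y: "?y \<in> polys_in {..<n}"
        using i by (auto intro!: polys_in_closed)
      have "?o \<le> D"
        using order_degree[OF u(1)[OF i], of "a i"] deg[OF i] by simp
      then have "?y ^ D = ?y ^ ?o * ?y ^ (D - ?o)"
        by (simp flip: power_add)
      moreover have "\<rho> = upoly i (r i) * ?rest"
        unfolding \<rho>_def using i by (subst prod.remove[of _ i]) auto
      moreover have "upoly i (u i) = ?y ^ ?o * upoly i (r i)"
        by (subst r(1)[OF i]) (simp only: upoly_mult upoly_power upoly_linear)
      ultimately have "\<rho> * ?y ^ D = ?rest * ?y ^ (D - ?o) * upoly i (u i)"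
        by (simp add: mult_ac)
      moreover have "?rest * ?y ^ (D - ?o) \<in> polys_in {..<n}"
        using y by (auto intro!: polys_in_mult polys_in_prod polys_in_power upoly_in_polys_in)
      ultimately show ?thesis
        using poly_ideal_mult[OF Q u(2)[OF i]] y by (auto simp: colon_def intro: polys_in_power)
    qed
    then have "point_power n a (Suc (\<Sum>i<n. D)) \<subseteq> colon n Q \<rho>"
      by (intro point_power_subset ideal_colon Q \<rho>R)
    then have sub: "point_power n a (Suc (n * D)) \<subseteq> colon n Q \<rho>"
      by simp
    obtain j h where jh: "j \<in> Q" "h \<in> point_power n a (Suc (n * D))" "f = j + h"
      using split[OF a(1)] by blast
    have "\<rho> * h \<in> Q"
      using jh(2) sub by (auto simp: colon_def)
    then have "f * \<rho> \<in> Q"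
      using jh(1) \<rho>R by (simp add: jh(3) algebra_simps poly_ideal_add[OF Q] poly_ideal_mult[OF Q])
    then have "eval_at a \<rho> = 0"
      using \<rho>R by (intro a(2)) (simp add: colon_def)
    then show False
      using r(2) by (simp add: \<rho>_def)
  qed
qed

section \<open>Generic freeness\<close>

text \<open>
  Here $S$ is a set of variables and $R/I$ is regarded as a module over $B = k[S]$. The set
  \<open>span_mod S I W\<close> is the preimage in $R$ of the submodule generated by $W$, and
  \<open>local_span S I c W\<close> is the preimage of the same submodule after inverting $c$. Powers of $c$ are
  allowed because finitely many generators have to serve infinitely many elements.
\<close>

definition span_mod :: "nat set \<Rightarrow> 'k::comm_ring_1 mpoly set \<Rightarrow> 'k mpoly set \<Rightarrow> 'k mpoly set"
  where "span_mod S I W =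
    {g. \<exists>\<phi>. (\<forall>w. \<phi> w \<in> polys_in S) \<and> g - (\<Sum>w\<in>W. \<phi> w * w) \<in> I}"

definition local_span ::
    "nat set \<Rightarrow> 'k::comm_ring_1 mpoly set \<Rightarrow> 'k mpoly \<Rightarrow> 'k mpoly set \<Rightarrow> 'k mpoly set"
  where "local_span S I c W = {g. \<exists>s. c ^ s * g \<in> span_mod S I W}"

definition indep_mod :: "nat set \<Rightarrow> 'k::comm_ring_1 mpoly set \<Rightarrow> 'k mpoly set \<Rightarrow> bool"
  where "indep_mod S I U \<longleftrightarrow>
    (\<forall>\<phi>. (\<forall>u. \<phi> u \<in> polys_in S) \<longrightarrow> (\<Sum>u\<in>U. \<phi> u * u) \<in> I \<longrightarrow> (\<forall>u\<in>U. \<phi> u = 0))"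

lemma local_span_cancel_power: "c ^ k * g \<in> local_span S I c W \<Longrightarrow> g \<in> local_span S I c W"
  unfolding local_span_def by (auto simp: mult.assoc[symmetric] power_add[symmetric])

lemma local_span_cancel: "c * g \<in> local_span S I c W \<Longrightarrow> g \<in> local_span S I c W"
  using local_span_cancel_power[of c 1 g] by simp

context
  fixes I :: "'k::comm_ring_1 mpoly set" and n :: nat and S :: "nat set"
  assumes I: "ideal I (poly_ring n)" and S: "S \<subseteq> {..<n}"
begin

lemma coeff_carrier: "r \<in> polys_in S \<Longrightarrow> r \<in> polys_in {..<n}"
  using S by (rule polys_in_mono)

lemma span_mod_ideal: "g \<in> I \<Longrightarrow> g \<in> span_mod S I W"
  unfolding span_mod_def by (intro CollectI exI[of _ "\<lambda>_. 0"]) simp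

lemma span_mod_add:
  assumes "g \<in> span_mod S I W" "h \<in> span_mod S I W"
  shows "g + h \<in> span_mod S I W"
proof -
  obtain \<phi> \<psi> where "\<forall>w. \<phi> w \<in> polys_in S" "\<forall>w. \<psi> w \<in> polys_in S"
    and eq: "g - (\<Sum>w\<in>W. \<phi> w * w) \<in> I" "h - (\<Sum>w\<in>W. \<psi> w * w) \<in> I"
    using assms unfolding span_mod_def by blast
  moreover have "(g - (\<Sum>w\<in>W. \<phi> w * w)) + (h - (\<Sum>w\<in>W. \<psi> w * w))
      = g + h - (\<Sum>w\<in>W. (\<phi> w + \<psi> w) * w)"
    by (simp add: distrib_right sum.distrib)
  then have "g + h - (\<Sum>w\<in>W. (\<phi> w + \<psi> w) * w) \<in> I"
    using poly_ideal_add[OF I eq] by (simp only:)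
  ultimately show ?thesis
    unfolding span_mod_def
    by (intro CollectI exI[of _ "\<lambda>w. \<phi> w + \<psi> w"]) (auto intro: polys_in_add)
qed

lemma span_mod_mult:
  assumes "r \<in> polys_in S" "g \<in> span_mod S I W"
  shows "r * g \<in> span_mod S I W"
proof -
  obtain \<phi> where "\<forall>w. \<phi> w \<in> polys_in S" and eq: "g - (\<Sum>w\<in>W. \<phi> w * w) \<in> I"
    using assms(2) unfolding span_mod_def by blast
  moreover have "r * g - (\<Sum>w\<in>W. (r * \<phi> w) * w) = r * (g - (\<Sum>w\<in>W. \<phi> w * w))"
    by (simp add: right_diff_distrib sum_distrib_left mult.assoc)
  ultimately show ?thesis
    unfolding span_mod_def using poly_ideal_mult[OF I eq coeff_carrier[OF assms(1)]] assms(1)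
    by (intro CollectI exI[of _ "\<lambda>w. r * \<phi> w"]) (auto intro: polys_in_mult)
qed

lemma span_mod_gen:
  assumes "finite W" "w \<in> W"
  shows "w \<in> span_mod S I W"
proof -
  have "(\<Sum>v\<in>W. (if v = w then 1 else 0) * v) = (\<Sum>v\<in>W. if v = w then v else 0)"
    by (intro sum.cong) auto
  then have "(\<Sum>v\<in>W. (if v = w then 1 else 0) * v) = w"
    using assms by simp
  then show ?thesis
    unfolding span_mod_def using poly_ideal_0[OF I]
    by (intro CollectI exI[of _ "\<lambda>v. if v = w then 1 else 0"]) simp
qed

lemma span_subset_local_span: "g \<in> span_mod S I W \<Longrightarrow> g \<in> local_span S I c W"
  unfolding local_span_def by (intro CollectI exI[of _ 0]) simp

lemma local_span_mult:
  assumes "r \<in> polys_in S" "g \<in> local_span S I c W"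
  shows "r * g \<in> local_span S I c W"
  using assms span_mod_mult[of r] by (auto simp: local_span_def mult.left_commute)

lemma local_span_coarsen:
  assumes "g \<in> local_span S I c W" "d \<in> polys_in S"
  shows "g \<in> local_span S I (c * d) W"
proof -
  obtain s where "c ^ s * g \<in> span_mod S I W"
    using assms(1) by (auto simp: local_span_def)
  then have "d ^ s * (c ^ s * g) \<in> span_mod S I W"
    by (rule span_mod_mult[OF polys_in_power[OF assms(2)]])
  moreover have "(c * d) ^ s * g = d ^ s * (c ^ s * g)"
    by (simp add: power_mult_distrib algebra_simps)
  ultimately show ?thesis
    unfolding local_span_def by (intro CollectI exI[of _ s]) (simp only:)
qed

context
  fixes c :: "'k mpoly"
  assumes c: "c \<in> polys_in S"
begin

lemma local_span_add:
  assumes "g \<in> local_span S I c W" "h \<in> local_span S I c W"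
  shows "g + h \<in> local_span S I c W"
proof -
  obtain s t where "c ^ s * g \<in> span_mod S I W" "c ^ t * h \<in> span_mod S I W"
    using assms by (auto simp: local_span_def)
  then have "c ^ t * (c ^ s * g) + c ^ s * (c ^ t * h) \<in> span_mod S I W"
    by (rule span_mod_add[OF span_mod_mult[OF polys_in_power[OF c]]
          span_mod_mult[OF polys_in_power[OF c]]])
  moreover have "c ^ (s + t) * (g + h) = c ^ t * (c ^ s * g) + c ^ s * (c ^ t * h)"
    by (simp add: power_add algebra_simps)
  ultimately show ?thesis
    unfolding local_span_def by (intro CollectI exI[of _ "s + t"]) (simp only:)
qed

lemma local_span_sum:
  "(\<And>x. x \<in> A \<Longrightarrow> f x \<in> local_span S I c W) \<Longrightarrow> sum f A \<in> local_span S I c W"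
  by (induct A rule: infinite_finite_induct)
    (auto intro: local_span_add span_subset_local_span span_mod_ideal poly_ideal_0[OF I])

lemma local_span_trans:
  assumes g: "g \<in> local_span S I c W" and h: "h \<in> polys_in {..<n}"
    and W: "\<And>w. w \<in> W \<Longrightarrow> h * w \<in> local_span S I c W'"
  shows "h * g \<in> local_span S I c W'"
proof -
  obtain s \<phi> where \<phi>: "\<forall>w. \<phi> w \<in> polys_in S" and eq: "c ^ s * g - (\<Sum>w\<in>W. \<phi> w * w) \<in> I"
    using g by (auto simp: local_span_def span_mod_def)
  have "h * (c ^ s * g - (\<Sum>w\<in>W. \<phi> w * w)) \<in> local_span S I c W'"
    using poly_ideal_mult[OF I eq h] by (intro span_subset_local_span span_mod_ideal)
  moreover have "\<phi> w * (h * w) \<in> local_span S I c W'" if "w \<in> W" for w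
    using \<phi> W[OF that] by (intro local_span_mult[of "\<phi> w"]) auto
  then have "(\<Sum>w\<in>W. \<phi> w * (h * w)) \<in> local_span S I c W'"
    by (rule local_span_sum)
  ultimately have "h * (c ^ s * g - (\<Sum>w\<in>W. \<phi> w * w)) + (\<Sum>w\<in>W. \<phi> w * (h * w))
      \<in> local_span S I c W'"
    by (rule local_span_add)
  also have "h * (c ^ s * g - (\<Sum>w\<in>W. \<phi> w * w)) + (\<Sum>w\<in>W. \<phi> w * (h * w)) = c ^ s * (h * g)"
    by (simp add: right_diff_distrib sum_distrib_left mult_ac)
  finally show ?thesis
    by (rule local_span_cancel_power)
qed

end

text \<open>
  Where the leading coefficient of an equation for $x_i$ is invertible, the equation rewrites
  every power of $x_i$ in terms of the first $D$ ones.
\<close>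

lemma var_powers_local_span:
  assumes i: "i < n" and \<gamma>: "\<And>j. \<gamma> j \<in> polys_in S"
    and rel: "(\<Sum>j\<le>D. \<gamma> j * var i ^ j) \<in> I"
  shows "var i ^ m \<in> local_span S I (\<gamma> D) ((\<lambda>j. var i ^ j) ` {..<D})"
    (is "_ \<in> ?L")
proof (induct m rule: less_induct)
  case (less m)
  show ?case
  proof (cases "m < D")
    case True
    then show ?thesis
      by (intro span_subset_local_span span_mod_gen) auto
  next
    case False
    then obtain k where k: "m = k + D"
      by (metis add.commute le_add_diff_inverse not_less)
    have "var i ^ k * (\<Sum>j\<le>D. \<gamma> j * var i ^ j) \<in> ?L"
      using i by (intro span_subset_local_span span_mod_ideal poly_ideal_mult[OF I rel])
        (auto intro!: polys_in_closed)
    moreover have "(\<Sum>j<D. (- \<gamma> j) * var i ^ (k + j)) \<in> ?L"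
      using k by (intro local_span_sum local_span_mult \<gamma> polys_in_uminus less) auto
    ultimately have "var i ^ k * (\<Sum>j\<le>D. \<gamma> j * var i ^ j) + (\<Sum>j<D. (- \<gamma> j) * var i ^ (k + j)) \<in> ?L"
      by (intro local_span_add \<gamma>)
    also have "var i ^ k * (\<Sum>j\<le>D. \<gamma> j * var i ^ j) + (\<Sum>j<D. (- \<gamma> j) * var i ^ (k + j))
        = \<gamma> D * var i ^ m"
      by (simp add: k lessThan_Suc_atMost[symmetric] sum_distrib_left power_add sum_negf algebra_simps)
    finally show ?thesis
      by (rule local_span_cancel)
  qed
qed

text \<open>
  Adding the variables in $T$ one by one, the generators are multiplied at each step by the
  powers of the new variable below the degree of its equation.
\<close>

lemma generically_finite:
  assumes "finite T" "T \<subseteq> {..<n}" and \<gamma>: "\<And>i j. \<gamma> i j \<in> polys_in S"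
    and rel: "\<And>i. i \<in> T \<Longrightarrow> (\<Sum>j\<le>D i. \<gamma> i j * var i ^ j) \<in> I"
  shows "\<exists>W. finite W \<and> W \<subseteq> polys_in {..<n} \<and>
    (\<forall>g\<in>polys_in (S \<union> T). g \<in> local_span S I (\<Prod>i\<in>T. \<gamma> i (D i)) W)"
  using assms(1,2,4)
proof (induct T)
  case empty
  have "g * 1 \<in> span_mod S I {1}" if "g \<in> polys_in S" for g
    using that by (intro span_mod_mult span_mod_gen) auto
  then show ?case
    by (intro exI[of _ "{1}"]) (auto intro: span_subset_local_span)
next
  case (insert i T)
  let ?e = "\<Prod>i\<in>T. \<gamma> i (D i)" and ?c = "\<Prod>i\<in>insert i T. \<gamma> i (D i)"
  have c: "?e \<in> polys_in S" "?c \<in> polys_in S"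
    using \<gamma> by (auto intro!: polys_in_prod)
  have c_eq: "?c = \<gamma> i (D i) * ?e"
    using insert.hyps by simp
  then have c_eq': "?c = ?e * \<gamma> i (D i)"
    by (simp only: mult.commute)
  have "\<exists>W. finite W \<and> W \<subseteq> polys_in {..<n} \<and> (\<forall>g\<in>polys_in (S \<union> T). g \<in> local_span S I ?e W)"
    by (rule insert.hyps(3)) (use insert.prems in auto)
  then obtain W0 where W0: "finite W0" "W0 \<subseteq> polys_in {..<n}"
    "\<And>g. g \<in> polys_in (S \<union> T) \<Longrightarrow> g \<in> local_span S I ?e W0"
    by blast
  let ?X = "(\<lambda>j. var i ^ j) ` {..<D i}"
  let ?W = "(\<lambda>(w, x). w * x) ` (W0 \<times> ?X)"
  have i: "i < n" "var i \<in> polys_in {..<n}"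
    using insert.prems by (auto intro: polys_in_var)
  have fin: "finite ?W" and W: "?W \<subseteq> polys_in {..<n}"
    using W0 i by (auto intro!: polys_in_mult polys_in_power)
  have pow: "var i ^ m \<in> local_span S I ?c ?X" for m
    unfolding c_eq
    by (rule local_span_coarsen[OF var_powers_local_span[OF i(1) \<gamma>] c(1)])
      (use insert.prems in simp)
  have w_pow: "w * var i ^ m \<in> local_span S I ?c ?W" if "w \<in> W0" for w m
    using that W0(2) fin
    by (intro local_span_trans[OF c(2) pow] span_subset_local_span span_mod_gen) auto
  have pow_g: "var i ^ m * g \<in> local_span S I ?c ?W" if "g \<in> polys_in (S \<union> T)" for g m
  proof -
    have "g \<in> local_span S I ?c W0"
      unfolding c_eq' by (rule local_span_coarsen[OF W0(3)[OF that] \<gamma>])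
    then show ?thesis
    proof (rule local_span_trans[OF c(2) _ polys_in_power[OF i(2)]])
      fix w assume "w \<in> W0"
      then show "var i ^ m * w \<in> local_span S I ?c ?W"
        unfolding mult.commute[of "var i ^ m" w] by (rule w_pow)
    qed
  qed
  have "g \<in> local_span S I ?c ?W" if "g \<in> polys_in (S \<union> insert i T)" for g
  proof -
    have "g \<in> polys_in (insert i (S \<union> T))"
      using that by simp
    then obtain E \<delta> where \<delta>: "\<And>j. \<delta> j \<in> polys_in (S \<union> T)" "g = (\<Sum>j\<le>E. \<delta> j * var i ^ j)"
      using polys_in_expansion by blast
    have "\<delta> j * var i ^ j \<in> local_span S I ?c ?W" for j
      unfolding mult.commute[of "\<delta> j"] by (rule pow_g[OF \<delta>(1)])
    then show ?thesis
      unfolding \<delta>(2) by (intro local_span_sum c)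
  qed
  then show ?case
    using fin W by blast
qed

end

text \<open>
  Generic freeness: among the generators $W$ take a maximal subset $U$ that is linearly
  independent over $B$. Every $w \in W$ has a nonzero multiple $b_w w$ in the span of $U$, so
  that inverting $c$ and all the $b_w$ makes $U$ a basis.
\<close>

lemma ex_generic_basis:
  fixes I :: "'k::field mpoly set"
  assumes I: "ideal I (poly_ring n)" and S: "S \<subseteq> {..<n}" and c: "c \<in> polys_in S" "c \<noteq> 0"
    and W: "finite W" "\<And>g. g \<in> polys_in {..<n} \<Longrightarrow> g \<in> local_span S I c W"
  shows "\<exists>U d. finite U \<and> indep_mod S I U \<and> d \<in> polys_in S \<and> d \<noteq> 0 \<and> c dvd d \<and>
    polys_in {..<n} \<subseteq> local_span S I d U"
proof -
  have "indep_mod S I {}"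
    by (simp add: indep_mod_def)
  then obtain U where U: "U \<subseteq> W" "indep_mod S I U"
    and max: "\<And>V. V \<subseteq> W \<Longrightarrow> indep_mod S I V \<Longrightarrow> U \<subseteq> V \<Longrightarrow> U = V"
    using finite_has_maximal2[of "{U. U \<subseteq> W \<and> indep_mod S I U}" "{}"] W(1) by auto
  have finU: "finite U"
    using U(1) W(1) by (rule finite_subset)
  have "\<exists>b. b \<in> polys_in S \<and> b \<noteq> 0 \<and> b * w \<in> span_mod S I U" if w: "w \<in> W" for w
  proof (cases "w \<in> U")
    case True
    then show ?thesis
      using span_mod_gen[OF I S finU] by (intro exI[of _ 1]) auto
  next
    case False
    then have "\<not> indep_mod S I (insert w U)"
      using max[of "insert w U"] U w by auto
    then obtain \<phi> where \<phi>: "\<forall>u. \<phi> u \<in> polys_in S" "(\<Sum>u\<in>insert w U. \<phi> u * u) \<in> I"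
      and nz: "\<exists>u\<in>insert w U. \<phi> u \<noteq> 0"
      unfolding indep_mod_def by blast
    have sum: "\<phi> w * w + (\<Sum>u\<in>U. \<phi> u * u) \<in> I"
      using \<phi>(2) False finU by simp
    have "\<phi> w \<noteq> 0"
    proof
      assume 0: "\<phi> w = 0"
      then have "(\<Sum>u\<in>U. \<phi> u * u) \<in> I"
        using sum by simp
      then have "\<forall>u\<in>U. \<phi> u = 0"
        using U(2) \<phi>(1) unfolding indep_mod_def by blast
      then show False
        using nz 0 by auto
    qed
    moreover have "\<phi> w * w \<in> span_mod S I U"
      unfolding span_mod_def using \<phi>(1) sum
      by (intro CollectI exI[of _ "\<lambda>u. - \<phi> u"]) (auto simp: sum_negf intro: polys_in_uminus)
    ultimately show ?thesis
      using \<phi>(1) by blast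
  qed
  then obtain b where b: "\<And>w. w \<in> W \<Longrightarrow> b w \<in> polys_in S" "\<And>w. w \<in> W \<Longrightarrow> b w \<noteq> 0"
    "\<And>w. w \<in> W \<Longrightarrow> b w * w \<in> span_mod S I U"
    by metis
  define d where "d = c * (\<Prod>w\<in>W. b w)"
  have P: "(\<Prod>w\<in>W. b w) \<in> polys_in S"
    using b(1) by (rule polys_in_prod)
  have d: "d \<in> polys_in S" "d \<noteq> 0"
    unfolding d_def using P c b(2) W(1) by (auto intro: polys_in_mult)
  have W_span: "w \<in> local_span S I d U" if w: "w \<in> W" for w
  proof -
    have "d * w = (c * (\<Prod>v\<in>W - {w}. b v)) * (b w * w)"
      unfolding d_def using prod.remove[OF W(1) w, of b] by (simp add: mult_ac)
    moreover have "c * (\<Prod>v\<in>W - {w}. b v) \<in> polys_in S"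
      using c b(1) by (intro polys_in_mult polys_in_prod) auto
    ultimately have "d * w \<in> span_mod S I U"
      by (simp only: span_mod_mult[OF I S _ b(3)[OF w]])
    then show ?thesis
      by (intro local_span_cancel[of d w] span_subset_local_span[OF I S])
  qed
  have "g \<in> local_span S I d U" if g: "g \<in> polys_in {..<n}" for g
  proof -
    have "g \<in> local_span S I d W"
      unfolding d_def by (rule local_span_coarsen[OF I S W(2)[OF g] P])
    then have "1 * g \<in> local_span S I d U"
      using W_span by (intro local_span_trans[OF I S d(1), of g W 1]) auto
    then show ?thesis
      by simp
  qed
  then have "polys_in {..<n} \<subseteq> local_span S I d U"
    by blast
  moreover have "c dvd d"
    by (simp add: d_def)
  ultimately show ?thesis
    using finU U(2) d by blast
qed

section \<open>Fibres over the points of an affine space\<close>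

text \<open>
  The ideal of the scheme-theoretic fibre over $b$ of the projection of the zero scheme of $I$ to
  the coordinates in $S$.
\<close>

definition fibre :: "nat \<Rightarrow> nat set \<Rightarrow> 'k::comm_ring_1 mpoly set \<Rightarrow> (nat \<Rightarrow> 'k) \<Rightarrow> 'k mpoly set"
  where "fibre n S I b = adjoin n I S (\<lambda>l. var l - const (b l))"

text \<open>
  The set of elements whose coordinates, up to a power of $d$, can be chosen to vanish at $b$ is
  closed under addition. It contains $I$, and also every multiple of $x_l - b_l$, since
  multiplying an element by $x_l - b_l \in B$ multiplies its coordinates by the same factor.
\<close>

lemma coordinates_vanish_on_fibre:
  fixes I :: "'k::comm_ring_1 mpoly set"
  assumes I: "ideal I (poly_ring n)" and S: "S \<subseteq> {..<n}" and d: "d \<in> polys_in S"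
    and gen: "\<And>g. g \<in> polys_in {..<n} \<Longrightarrow> g \<in> local_span S I d U"
    and f: "f \<in> fibre n S I b"
  shows "\<exists>s \<psi>. (\<forall>u. \<psi> u \<in> polys_in S) \<and> (\<forall>u. eval_at b (\<psi> u) = 0) \<and>
    d ^ s * f - (\<Sum>u\<in>U. \<psi> u * u) \<in> I"
proof -
  define V where "V = {h. \<exists>s \<psi>. (\<forall>u. \<psi> u \<in> polys_in S) \<and> (\<forall>u. eval_at b (\<psi> u) = 0) \<and>
    d ^ s * h - (\<Sum>u\<in>U. \<psi> u * u) \<in> I}"
  have V_ideal: "h \<in> V" if "h \<in> I" for h
    unfolding V_def using that by (intro CollectI exI[of _ 0] exI[of _ "\<lambda>_. 0"]) simp
  have V_add: "g + h \<in> V" if "g \<in> V" "h \<in> V" for g h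
  proof -
    obtain s \<phi> t \<psi> where \<phi>: "\<forall>u. \<phi> u \<in> polys_in S" "\<forall>u. eval_at b (\<phi> u) = 0"
      and \<psi>: "\<forall>u. \<psi> u \<in> polys_in S" "\<forall>u. eval_at b (\<psi> u) = 0"
      and eq: "d ^ s * g - (\<Sum>u\<in>U. \<phi> u * u) \<in> I" "d ^ t * h - (\<Sum>u\<in>U. \<psi> u * u) \<in> I"
      using \<open>g \<in> V\<close> \<open>h \<in> V\<close> unfolding V_def by blast
    have "d ^ t * (d ^ s * g - (\<Sum>u\<in>U. \<phi> u * u)) + d ^ s * (d ^ t * h - (\<Sum>u\<in>U. \<psi> u * u)) \<in> I"
      using polys_in_mono[OF S d] eq
      by (intro poly_ideal_add[OF I] poly_ideal_mult[OF I] polys_in_power)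
    also have "d ^ t * (d ^ s * g - (\<Sum>u\<in>U. \<phi> u * u)) + d ^ s * (d ^ t * h - (\<Sum>u\<in>U. \<psi> u * u))
        = d ^ (s + t) * (g + h) - (\<Sum>u\<in>U. (d ^ t * \<phi> u + d ^ s * \<psi> u) * u)"
      by (simp add: power_add algebra_simps sum_distrib_left sum.distrib)
    finally show ?thesis
      unfolding V_def using \<phi> \<psi> d
      by (intro CollectI exI[of _ "s + t"] exI[of _ "\<lambda>u. d ^ t * \<phi> u + d ^ s * \<psi> u"])
        (auto intro!: polys_in_closed)
  qed
  have V_gen: "g * (var l - const (b l)) \<in> V" if g: "g \<in> polys_in {..<n}" and l: "l \<in> S" for g l
  proof -
    let ?y = "var l - const (b l)"
    obtain s \<phi> where \<phi>: "\<forall>u. \<phi> u \<in> polys_in S" and eq: "d ^ s * g - (\<Sum>u\<in>U. \<phi> u * u) \<in> I"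
      using gen[OF g] unfolding local_span_def span_mod_def by blast
    have y: "?y \<in> polys_in S"
      using l by (intro polys_in_diff polys_in_var polys_in_const)
    have "?y * (d ^ s * g - (\<Sum>u\<in>U. \<phi> u * u)) \<in> I"
      by (rule poly_ideal_mult[OF I eq polys_in_mono[OF S y]])
    also have "?y * (d ^ s * g - (\<Sum>u\<in>U. \<phi> u * u))
        = d ^ s * (g * ?y) - (\<Sum>u\<in>U. (?y * \<phi> u) * u)"
      by (simp add: right_diff_distrib[of ?y] sum_distrib_left mult_ac)
    finally show ?thesis
      unfolding V_def using \<phi> y
      by (intro CollectI exI[of _ s] exI[of _ "\<lambda>u. ?y * \<phi> u"]) (auto intro!: polys_in_mult)
  qed
  have V_sum: "sum h A \<in> V" if "\<And>x. x \<in> A \<Longrightarrow> h x \<in> V" for h and A :: "nat set"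
    using that by (induct A rule: infinite_finite_induct)
      (auto intro: V_add V_ideal poly_ideal_0[OF I])
  have "f \<in> V"
  proof -
    obtain i g where "f = i + (\<Sum>l\<in>S. g l * (var l - const (b l)))" "i \<in> I"
      "\<forall>l. g l \<in> polys_in {..<n}"
      using f unfolding fibre_def adjoin_def by blast
    then show ?thesis
      by (simp only:) (intro V_add V_sum V_gen V_ideal; simp)
  qed
  then show ?thesis
    unfolding V_def by blast
qed

text \<open>
  By linear independence, the coordinates of $f$ agree up to powers of $d$ with those that
  vanish at $b$. So $d$ times a coordinate vanishes at every point, including the points with
  $d(b) = 0$.
\<close>

lemma mem_ideal_if_mem_fibres:
  fixes I :: "'k::alg_closed_field mpoly set"
  assumes I: "ideal I (poly_ring n)" and S: "S \<subseteq> {..<n}"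
    and torsion_free: "\<And>b g. b \<in> polys_in S \<Longrightarrow> b \<noteq> 0 \<Longrightarrow> g \<in> polys_in {..<n} \<Longrightarrow> b * g \<in> I \<Longrightarrow> g \<in> I"
    and d: "d \<in> polys_in S" "d \<noteq> 0" and U: "finite U" "indep_mod S I U"
    and gen: "\<And>g. g \<in> polys_in {..<n} \<Longrightarrow> g \<in> local_span S I d U"
    and f: "f \<in> polys_in {..<n}" "\<And>b. eval_at b d \<noteq> 0 \<Longrightarrow> f \<in> fibre n S I b"
  shows "f \<in> I"
proof -
  have dR: "d \<in> polys_in {..<n}"
    by (rule polys_in_mono[OF S d(1)])
  obtain s \<phi> where \<phi>: "\<forall>u. \<phi> u \<in> polys_in S" and eq: "d ^ s * f - (\<Sum>u\<in>U. \<phi> u * u) \<in> I"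
    using gen[OF f(1)] unfolding local_span_def span_mod_def by blast
  have "\<phi> u = 0" if u: "u \<in> U" for u
  proof -
    have "eval_at b (d * \<phi> u) = 0" for b
    proof (cases "eval_at b d = 0")
      case False
      obtain t \<psi> where \<psi>: "\<forall>u. \<psi> u \<in> polys_in S" "\<forall>u. eval_at b (\<psi> u) = 0"
        and eq': "d ^ t * f - (\<Sum>u\<in>U. \<psi> u * u) \<in> I"
        using coordinates_vanish_on_fibre[OF I S d(1) gen f(2)[OF False]] by blast
      have "d ^ s * (d ^ t * f - (\<Sum>u\<in>U. \<psi> u * u)) - d ^ t * (d ^ s * f - (\<Sum>u\<in>U. \<phi> u * u)) \<in> I"
        by (rule poly_ideal_diff[OF I poly_ideal_mult[OF I eq' polys_in_power[OF dR]]
              poly_ideal_mult[OF I eq polys_in_power[OF dR]]])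
      also have "d ^ s * (d ^ t * f - (\<Sum>u\<in>U. \<psi> u * u)) - d ^ t * (d ^ s * f - (\<Sum>u\<in>U. \<phi> u * u))
          = (\<Sum>u\<in>U. (d ^ t * \<phi> u - d ^ s * \<psi> u) * u)"
        by (simp add: algebra_simps sum_distrib_left sum_subtractf)
      finally have rel: "(\<Sum>u\<in>U. (d ^ t * \<phi> u - d ^ s * \<psi> u) * u) \<in> I" .
      have "\<forall>u. d ^ t * \<phi> u - d ^ s * \<psi> u \<in> polys_in S"
        using d \<phi> \<psi>(1) by (auto intro!: polys_in_closed)
      then have "d ^ t * \<phi> u - d ^ s * \<psi> u = 0"
        using U(2) rel u unfolding indep_mod_def
        by (elim allE[of _ "\<lambda>u. d ^ t * \<phi> u - d ^ s * \<psi> u"]) blast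
      then have "eval_at b (d ^ t * \<phi> u - d ^ s * \<psi> u) = 0"
        by simp
      then show ?thesis
        using False \<psi>(2) by simp
    qed simp
    moreover have "finite S"
      using S by (rule finite_subset) simp
    ultimately have "d * \<phi> u = 0"
      using d \<phi> by (intro eval_zero_imp_zero[of S]) (auto intro: polys_in_mult)
    then show ?thesis
      using d by simp
  qed
  then have "d ^ s * f \<in> I"
    using eq by simp
  then show ?thesis
    using d f(1) by (auto intro: torsion_free[OF polys_in_power[OF d(1)]])
qed

section \<open>Stabilization for an arbitrary ideal\<close>

lemma ideal_fibre:
  assumes "ideal I (poly_ring n)" "S \<subseteq> {..<n}"
  shows "ideal (fibre n S I b) (poly_ring n)"
  unfolding fibre_def
  by (intro ideal_adjoin[OF assms(1)] polys_in_diff polys_in_var polys_in_const)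
    (use assms(2) in blast)

text \<open>
  The generic fibres are zero-dimensional with degree bounds that do not depend on the point, so
  a single exponent works for all of them.
\<close>

lemma torsion_free_stabilization:
  fixes I :: "'k::alg_closed_field mpoly set"
  assumes I: "ideal I (poly_ring n)" and S: "S \<subseteq> {..<n}"
    and algebraic: "\<And>i. i \<in> {..<n} - S \<Longrightarrow> \<exists>p\<in>I. p \<in> polys_in (insert i S) \<and> p \<noteq> 0"
    and torsion_free: "\<And>b g. b \<in> polys_in S \<Longrightarrow> b \<noteq> 0 \<Longrightarrow> g \<in> polys_in {..<n} \<Longrightarrow> b * g \<in> I \<Longrightarrow> g \<in> I"
  shows "\<exists>e\<ge>1. Phi_star n e I \<subseteq> I"
proof -
  let ?T = "{..<n} - S"
  define is_relation where "is_relation i D \<gamma> \<longleftrightarrow> (\<forall>j. \<gamma> j \<in> polys_in S) \<and>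
    (i \<in> ?T \<longrightarrow> (\<Sum>j\<le>D. \<gamma> j * var i ^ j) \<in> I \<and> \<gamma> D \<noteq> 0)" for i D \<gamma>
  have "\<exists>D \<gamma>. is_relation i D \<gamma>" for i
  proof (cases "i \<in> ?T")
    case True
    then obtain p where p: "p \<in> I" "p \<in> polys_in (insert i S)" "p \<noteq> 0"
      using algebraic by blast
    then show ?thesis
      unfolding is_relation_def using polys_in_expansion_lead[OF p(2,3)] by blast
  next
    case False
    then show ?thesis
      unfolding is_relation_def by (intro exI[of _ 0] exI[of _ "\<lambda>_. 0"]) simp
  qed
  then obtain D \<gamma> where "\<And>i. is_relation i (D i) (\<gamma> i)"
    by metis
  then have \<gamma>: "\<And>i j. \<gamma> i j \<in> polys_in S"
    and rel: "\<And>i. i \<in> ?T \<Longrightarrow> (\<Sum>j\<le>D i. \<gamma> i j * var i ^ j) \<in> I"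
    and lead: "\<And>i. i \<in> ?T \<Longrightarrow> \<gamma> i (D i) \<noteq> 0"
    unfolding is_relation_def by blast+
  define c where "c = (\<Prod>i\<in>?T. \<gamma> i (D i))"
  have c: "c \<in> polys_in S" "c \<noteq> 0"
    unfolding c_def using \<gamma> lead by (auto intro: polys_in_prod)
  have "S \<union> ?T = {..<n}"
    using S by blast
  then obtain W where W: "finite W" "\<And>g. g \<in> polys_in {..<n} \<Longrightarrow> g \<in> local_span S I c W"
    using generically_finite[OF I S, of ?T \<gamma> D] \<gamma> rel unfolding c_def by auto
  obtain U d where U: "finite U" "indep_mod S I U" and d: "d \<in> polys_in S" "d \<noteq> 0" "c dvd d"
    and gen: "polys_in {..<n} \<subseteq> local_span S I d U"
    using ex_generic_basis[OF I S c W] by blast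
  \<comment> \<open>The summand 1 accounts for the linear polynomials $X - b_l$ with $l \in S$.\<close>
  define E where "E = Suc (\<Sum>i\<in>?T. D i)"
  have fibres: "Phi_star n (Suc (n * E)) (fibre n S I b) \<subseteq> fibre n S I b" if b: "eval_at b d \<noteq> 0" for b
  proof -
    let ?Q = "fibre n S I b"
    have Q: "ideal ?Q (poly_ring n)"
      by (rule ideal_fibre[OF I S])
    have finS: "finite S"
      using S by (rule finite_subset) simp
    have gens: "var l - const (b l) \<in> ?Q" if "l \<in> S" for l
      unfolding fibre_def using adjoin_gen[OF I finS that, of "\<lambda>l. var l - const (b l)"] .
    have sub: "I \<subseteq> ?Q"
      unfolding fibre_def by (rule adjoin_superset)
    \<comment> \<open>The equation of $x_i$ with its coefficients specialized at $b$.\<close>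
    define v where "v i = (\<Sum>j\<le>D i. monom (eval_at b (\<gamma> i j)) j)" for i
    define u where "u i = (if i \<in> S then [:- b i, 1:] else v i)" for i
    have v_nz: "v i \<noteq> 0" if i: "i \<in> ?T" for i
    proof -
      have "eval_at b c \<noteq> 0"
        using b d(3) by (auto elim: dvdE)
      then have "eval_at b (\<gamma> i (D i)) \<noteq> 0"
        using i by (simp add: c_def)
      moreover have "coeff (v i) (D i) = eval_at b (\<gamma> i (D i))"
        by (simp add: v_def coeff_sum)
      ultimately show ?thesis
        by auto
    qed
    have v_in: "upoly i (v i) \<in> ?Q" if i: "i \<in> ?T" for i
    proof -
      have "(\<Sum>j\<le>D i. (\<gamma> i j - const (eval_at b (\<gamma> i j))) * var i ^ j) \<in> ?Q"
        using i gens finS S \<gamma>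
        by (intro poly_ideal_sum[OF Q] poly_ideal_mult_right[OF Q]
            diff_const_eval_in_ideal[OF Q finS S] polys_in_power polys_in_var) auto
      then have "(\<Sum>j\<le>D i. \<gamma> i j * var i ^ j)
          - (\<Sum>j\<le>D i. (\<gamma> i j - const (eval_at b (\<gamma> i j))) * var i ^ j) \<in> ?Q"
        using rel[OF i] sub by (intro poly_ideal_diff[OF Q]) auto
      also have "(\<Sum>j\<le>D i. \<gamma> i j * var i ^ j)
          - (\<Sum>j\<le>D i. (\<gamma> i j - const (eval_at b (\<gamma> i j))) * var i ^ j) = upoly i (v i)"
        by (simp add: v_def upoly_sum upoly_monom algebra_simps sum_subtractf)
      finally show ?thesis .
    qed
    have v_deg: "degree (v i) \<le> E" if i: "i \<in> ?T" for i
    proof -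
      have "degree (v i) \<le> D i"
        unfolding v_def by (intro degree_sum_le) (auto intro: order_trans[OF degree_monom_le])
      also have "D i \<le> (\<Sum>i\<in>?T. D i)"
        using i by (intro member_le_sum) auto
      finally show ?thesis
        by (simp add: E_def)
    qed
    show ?thesis
    proof (rule artinian_stabilization[OF Q])
      fix i assume "i < n"
      then show "u i \<noteq> 0" "upoly i (u i) \<in> ?Q" "degree (u i) \<le> E"
        using v_nz v_in v_deg gens by (auto simp: u_def E_def upoly_linear)
    qed
  qed
  have "Phi_star n (Suc (n * E)) I \<subseteq> I"
  proof
    fix f assume f: "f \<in> Phi_star n (Suc (n * E)) I"
    have fR: "f \<in> polys_in {..<n}"
      using f Phi_star_carrier[OF I] by blast
    have in_fibres: "f \<in> fibre n S I b" if "eval_at b d \<noteq> 0" for b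
      using f fibres[OF that] Phi_star_mono[of I "fibre n S I b"] adjoin_superset[of I n S]
      unfolding fibre_def by blast
    show "f \<in> I"
      by (rule mem_ideal_if_mem_fibres[OF I S torsion_free d(1,2) U subsetD[OF gen] fR in_fibres])
  qed
  then show ?thesis
    by (intro exI[of _ "Suc (n * E)"]) simp
qed

text \<open>
  If $x = i + gh$ with $i \in I$ and $hx \in I$, then $h^2 g \in I$, hence $hg \in I$ by stability.
\<close>

lemma ideal_eq_colon_inter_adjoin:
  fixes I :: "'k::comm_ring_1 mpoly set"
  assumes I: "ideal I (poly_ring n)" and h: "h \<in> polys_in {..<n}"
    and stable: "colon n I (h * h) = colon n I h"
  shows "I = colon n I h \<inter> adjoin n I {0} (\<lambda>_. h)"
proof
  show "I \<subseteq> colon n I h \<inter> adjoin n I {0} (\<lambda>_. h)"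
    using adjoin_superset[of I n "{0}" "\<lambda>_. h"] poly_ideal_carrier[OF I] poly_ideal_mult[OF I _ h]
    by (auto simp: colon_def)
  show "colon n I h \<inter> adjoin n I {0} (\<lambda>_. h) \<subseteq> I"
  proof
    fix x assume "x \<in> colon n I h \<inter> adjoin n I {0} (\<lambda>_. h)"
    then obtain i g where x: "h * x \<in> I" "x = i + g * h" "i \<in> I" "g \<in> polys_in {..<n}"
      by (auto simp: colon_def adjoin_def)
    have "h * x - h * i \<in> I"
      by (rule poly_ideal_diff[OF I x(1) poly_ideal_mult[OF I x(3) h]])
    moreover have "h * x - h * i = h * h * g"
      by (simp add: x(2) algebra_simps)
    ultimately have "g \<in> colon n I (h * h)"
      using x(4) by (simp add: colon_def)
    then have "h * g \<in> I"
      unfolding stable by (simp add: colon_def)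
    then show "x \<in> I"
      using x by (simp add: poly_ideal_add[OF I] mult.commute)
  qed
qed

text \<open>
  The ideals $(I : b^s)$ form an ascending chain. The requirement $s \ge 1$ keeps $b$ a factor of
  $b^s$, so that $(I : b)$ is contained in $(I : b^s)$.
\<close>

lemma ex_stable_colon_power:
  fixes I :: "'k::field mpoly set"
  assumes I: "ideal I (poly_ring n)" and b: "b \<in> polys_in {..<n}"
  shows "\<exists>s\<ge>1. colon n I (b ^ s * b ^ s) = colon n I (b ^ s)"
proof -
  have "\<exists>M\<in>(\<lambda>s. colon n I (b ^ s)) ` {1..}. \<forall>J\<in>(\<lambda>s. colon n I (b ^ s)) ` {1..}. \<not> M \<subset> J"
  proof (rule ex_maximal_ideal_in)
    show "ideal J (poly_ring n)" if "J \<in> (\<lambda>s. colon n I (b ^ s)) ` {1..}" for J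
      using that b by (auto intro: ideal_colon[OF I] polys_in_power)
    show "colon n I (b ^ 1) \<in> (\<lambda>s. colon n I (b ^ s)) ` {1..}"
      by (rule imageI) simp
  qed
  then obtain s where s: "s \<ge> 1"
    "\<And>t. t \<ge> 1 \<Longrightarrow> \<not> colon n I (b ^ s) \<subset> colon n I (b ^ t)"
    by auto
  have "colon n I (b ^ s) \<subseteq> colon n I (b ^ (s + s))"
    using poly_ideal_mult[OF I, of _ "b ^ s"] b
    by (auto simp: colon_def power_add mult.assoc intro: polys_in_power)
  then have "colon n I (b ^ (s + s)) = colon n I (b ^ s)"
    using s(2)[of "s + s"] s(1) by auto
  then show ?thesis
    using s(1) by (auto simp: power_add)
qed

text \<open>
  In the case where $b \in k[S]$ is a zero divisor modulo $I$ and $h = b^s$, the ideal $(I : h)$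
  is strictly larger than $I$ because it contains the element outside $I$ that $b$ multiplies into
  $I$, and $I + (h)$ is strictly larger because $h$ is a nonzero element of $k[S]$ and
  $k[S] \cap I = 0$.
\<close>

theorem Phi_star_stabilizes:
  fixes I :: "'k::alg_closed_field mpoly set"
  assumes "ideal I (poly_ring n)"
  shows "\<exists>e\<ge>1. Phi_star n e I \<subseteq> I"
  using assms
proof (induct I rule: wf_induct_rule[OF noetherian_poly_ring[of n]])
  case (1 I)
  note I = \<open>ideal I (poly_ring n)\<close>
  have IH: "\<exists>e\<ge>1. Phi_star n e J \<subseteq> J" if "ideal J (poly_ring n)" "I \<subset> J" for J
    using 1 that by blast
  show ?case
  proof (cases "1 \<in> I")
    case True
    then show ?thesis
      using Phi_star_carrier[OF I] poly_ideal_one_eq[OF I] by blast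
  next
    case False
    have "p = 0" if "p \<in> polys_in {}" "p \<in> I" for p
    proof (rule ccontr)
      assume "p \<noteq> 0"
      obtain k where k: "p = const k"
        using polys_in_empty[OF \<open>p \<in> polys_in {}\<close>] by blast
      then have "const (1 / k) * const k \<in> I"
        using that by (intro poly_ideal_mult[OF I]) auto
      then show False
        using False \<open>p \<noteq> 0\<close> k by (cases "k = 0") (auto simp flip: const_mult)
    qed
    then have empty: "polys_in {} \<inter> I \<subseteq> {0}"
      by blast
    let ?F = "{S. S \<subseteq> {..<n} \<and> polys_in S \<inter> I \<subseteq> {0}}"
    have "\<exists>S\<in>?F. {} \<subseteq> S \<and> (\<forall>S'\<in>?F. S \<subseteq> S' \<longrightarrow> S = S')"
      by (rule finite_has_maximal2) (use empty in auto)
    then obtain S where S: "S \<subseteq> {..<n}" "polys_in S \<inter> I \<subseteq> {0}"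
      and "\<forall>S'\<in>?F. S \<subseteq> S' \<longrightarrow> S = S'"
      by auto
    then have max: "S = S'" if "S' \<subseteq> {..<n}" "polys_in S' \<inter> I \<subseteq> {0}" "S \<subseteq> S'" for S'
      using that by simp
    have algebraic: "\<exists>p\<in>I. p \<in> polys_in (insert i S) \<and> p \<noteq> 0" if "i \<in> {..<n} - S" for i
      using max[of "insert i S"] S(1) that by blast
    show ?thesis
    proof (cases "\<forall>b g. b \<in> polys_in S \<longrightarrow> b \<noteq> 0 \<longrightarrow> g \<in> polys_in {..<n} \<longrightarrow> b * g \<in> I \<longrightarrow> g \<in> I")
      case True
      then show ?thesis
        using algebraic by (intro torsion_free_stabilization[OF I S(1)]) blast+
    next
      case False
      then obtain b g where b: "b \<in> polys_in S" "b \<noteq> 0"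
        and g: "g \<in> polys_in {..<n}" "b * g \<in> I" "g \<notin> I"
        by blast
      have bR: "b \<in> polys_in {..<n}"
        by (rule polys_in_mono[OF S(1) b(1)])
      obtain s where s: "s \<ge> 1" "colon n I (b ^ s * b ^ s) = colon n I (b ^ s)"
        using ex_stable_colon_power[OF I bR] by blast
      define h where "h = b ^ s"
      have h: "h \<in> polys_in {..<n}" "h \<in> polys_in S" "h \<noteq> 0"
        using b bR by (auto simp: h_def intro: polys_in_power)
      let ?J = "colon n I h" and ?K = "adjoin n I {0} (\<lambda>_. h)"
      have eq: "I = ?J \<inter> ?K"
        using s(2) by (intro ideal_eq_colon_inter_adjoin[OF I h(1)]) (simp add: h_def)
      have J: "ideal ?J (poly_ring n)" and K: "ideal ?K (poly_ring n)"
        using h by (auto intro!: ideal_colon[OF I] ideal_adjoin[OF I])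
      have "h * g \<in> I"
      proof -
        have "b ^ (s - 1) * (b * g) \<in> I"
          by (rule poly_ideal_mult[OF I g(2) polys_in_power[OF bR]])
        then show ?thesis
          using s(1) by (simp add: h_def power_eq_if mult_ac)
      qed
      then have "g \<in> ?J"
        using g(1) by (simp add: colon_def)
      then have "I \<subset> ?J"
        using eq g(3) by blast
      then obtain d where d: "d \<ge> 1" "Phi_star n d ?J \<subseteq> ?J"
        using IH[OF J] by blast
      have "h \<in> ?K"
        using adjoin_gen[OF I, of "{0}" 0 "\<lambda>_. h"] by simp
      moreover have "h \<notin> I"
        using h S(2) by blast
      ultimately have "I \<subset> ?K"
        using eq by blast
      then obtain e where e: "e \<ge> 1" "Phi_star n e ?K \<subseteq> ?K"
        using IH[OF K] by blast
      have "Phi_star n (max d e) I \<subseteq> Phi_star n d ?J \<inter> Phi_star n e ?K"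
        using Phi_star_mono[of I ?J n "max d e"] Phi_star_mono[of I ?K n "max d e"] eq
          Phi_star_antimono[of d "max d e" n ?J] Phi_star_antimono[of e "max d e" n ?K]
        by fastforce
      then have "Phi_star n (max d e) I \<subseteq> I"
        using d(2) e(2) eq by blast
      then show ?thesis
        using d(1) by (intro exI[of _ "max d e"]) auto
    qed
  qed
qed

section \<open>Comparison with the radical\<close>

text \<open>Modulo $I + \mathfrak{m}_a$ the polynomial $f$ is the constant $f(a)$, and $f(a)^m$ is $0$.\<close>

lemma radical_subset_Phi_star_1:
  fixes I :: "'k::field mpoly set"
  assumes I: "ideal I (poly_ring n)"
  shows "radical (poly_ring n) I \<subseteq> Phi_star n 1 I"
proof
  fix f assume "f \<in> radical (poly_ring n) I"
  then obtain m where f: "f \<in> polys_in {..<n}" and m: "m > 0" "f ^ m \<in> I"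
    by (auto simp: radical_def)
  have "f \<in> I <+>\<^bsub>poly_ring n\<^esub> point_ideal n a" for a
  proof -
    interpret cring "poly_ring n :: 'k mpoly ring"
      by (rule cring_poly_ring)
    let ?Q = "I <+>\<^bsub>poly_ring n\<^esub> point_ideal n a"
    have Q: "ideal ?Q (poly_ring n)"
      by (rule add_ideals[OF I ideal_point_ideal])
    have IQ: "x \<in> ?Q" if "x \<in> I" for x
      unfolding mem_set_add_poly_ring
      using that poly_ideal_0[OF ideal_point_ideal] by (intro bexI[of _ x] bexI[of _ 0]) auto
    have PQ: "x \<in> ?Q" if "x \<in> point_ideal n a" for x
      unfolding mem_set_add_poly_ring
      using that poly_ideal_0[OF I] by (intro bexI[of _ 0] bexI[of _ x]) auto
    have diff: "f - const (eval_at a f) \<in> ?Q"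
      using f gen_in_point_ideal PQ by (intro diff_const_eval_in_ideal[OF Q]) auto
    have "f ^ m - const (eval_at a f) ^ m \<in> ?Q"
      using f diff by (intro poly_ideal_diff_power[OF Q]) auto
    then have "f ^ m - (f ^ m - const (eval_at a f) ^ m) \<in> ?Q"
      by (rule poly_ideal_diff[OF Q IQ[OF m(2)]])
    then have "const (eval_at a f ^ m) \<in> ?Q"
      by (simp add: const_power)
    then have unit: "const (1 / eval_at a f ^ m) * const (eval_at a f ^ m) \<in> ?Q"
      by (intro poly_ideal_mult[OF Q]) auto
    show ?thesis
    proof (cases "eval_at a f = 0")
      case True
      then show ?thesis
        using diff by simp
    next
      case False
      then have "1 \<in> ?Q"
        using unit by (simp flip: const_mult)
      then show ?thesis
        using poly_ideal_one_eq[OF Q] f by blast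
    qed
  qed
  then show "f \<in> Phi_star n 1 I"
    unfolding Phi_star_def One_nat_def point_power_1 by blast
qed

lemma power_in_Phi_star:
  assumes I: "ideal I (poly_ring n)" and f: "f \<in> Phi_star n 1 I"
  shows "f ^ e \<in> Phi_star n e I"
proof -
  have fR: "f \<in> polys_in {..<n}"
    using f Phi_star_carrier[OF I] by blast
  have "f ^ e \<in> I <+>\<^bsub>poly_ring n\<^esub> point_power n a e" if "a \<in> affine_space n" for a
  proof -
    have "f \<in> I <+>\<^bsub>poly_ring n\<^esub> point_ideal n a"
      using f that unfolding Phi_star_def One_nat_def point_power_1 by (rule INT_D)
    then obtain i m where im: "i \<in> I" "m \<in> point_ideal n a" "f = i + m"
      unfolding mem_set_add_poly_ring by blast
    have "f ^ e - m ^ e \<in> I"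
      using im fR poly_ideal_carrier[OF ideal_point_ideal im(2)]
      by (intro poly_ideal_diff_power[OF I]) auto
    then show ?thesis
      unfolding mem_set_add_poly_ring using power_in_point_power[OF im(2)]
      by (intro bexI[of _ "f ^ e - m ^ e"] bexI[of _ "m ^ e"]) auto
  qed
  then show ?thesis
    unfolding Phi_star_def by blast
qed

text \<open>
  If $f \in I + \mathfrak{m}_a$ for all $a$, then $f^e \in I + \mathfrak{m}_a^e$ for all $a$, and
  stabilization applies to $f^e$. The case $q = 1$ is Hilbert's Nullstellensatz: a polynomial that
  vanishes on the zero set of $I$ belongs to $\Phi^{*}_1(I)$, since $I + \mathfrak{m}_a = R$ for
  all other points $a$.
\<close>

lemma Phi_star_subset_radical:
  fixes I :: "'k::alg_closed_field mpoly set"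
  assumes I: "ideal I (poly_ring n)" and "q \<ge> 1"
  shows "Phi_star n q I \<subseteq> radical (poly_ring n) I"
proof
  fix f assume f: "f \<in> Phi_star n q I"
  then have f1: "f \<in> Phi_star n 1 I"
    using Phi_star_antimono[OF \<open>q \<ge> 1\<close>] by blast
  obtain e where "e \<ge> 1" "Phi_star n e I \<subseteq> I"
    using Phi_star_stabilizes[OF I] by blast
  then have "f ^ e \<in> I" "e > 0"
    using power_in_Phi_star[OF I f1, of e] by auto
  then show "f \<in> radical (poly_ring n) I"
    using f Phi_star_carrier[OF I] by (auto simp: radical_def)
qed

lemma radical_mono: "I \<subseteq> J \<Longrightarrow> radical R I \<subseteq> radical R J"
  by (auto simp: radical_def)

lemma radical_radical_subset:
  "radical (poly_ring n) (radical (poly_ring n) I) \<subseteq> radical (poly_ring n) I"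
proof
  fix f assume "f \<in> radical (poly_ring n) (radical (poly_ring n) I)"
  then obtain m k where "f \<in> polys_in {..<n}" "m > 0" "k > 0" "(f ^ m) ^ k \<in> I"
    by (auto simp: radical_def)
  then show "f \<in> radical (poly_ring n) I"
    by (auto simp: radical_def power_mult[symmetric] intro!: exI[of _ "m * k"])
qed

theorem theorem6p3:
  fixes n :: nat and I :: "'k::alg_closed_field mpoly set"
  assumes "ideal I (poly_ring n)"
  shows "(\<forall>q\<ge>1.
            I \<subseteq> Phi_star n (q + 1) I \<and>
            Phi_star n (q + 1) I \<subseteq> Phi_star n q I \<and>
            Phi_star n q I \<subseteq> radical (poly_ring n) I \<and>
            radical (poly_ring n) (Phi_star n q I) = radical (poly_ring n) I) \<and>
         Phi_star n 1 I = radical (poly_ring n) I \<and>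
         (\<exists>e\<ge>1. \<forall>q\<ge>e. Phi_star n q I = I) \<and>
         (\<Inter>q\<in>{1..}. Phi_star n q I) = I"
proof (intro conjI allI impI)
  fix q :: nat assume q: "q \<ge> 1"
  show "I \<subseteq> Phi_star n (q + 1) I"
    by (rule subset_Phi_star)
  show "Phi_star n (q + 1) I \<subseteq> Phi_star n q I"
    using Phi_star_Suc_subset by simp
  show rad: "Phi_star n q I \<subseteq> radical (poly_ring n) I"
    by (rule Phi_star_subset_radical[OF assms q])
  show "radical (poly_ring n) (Phi_star n q I) = radical (poly_ring n) I"
    using radical_mono[OF rad, of "poly_ring n"] radical_mono[OF subset_Phi_star, of "poly_ring n" I n q]
      radical_radical_subset[of n I] by blast
next
  show "Phi_star n 1 I = radical (poly_ring n) I"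
    using radical_subset_Phi_star_1[OF assms] Phi_star_subset_radical[OF assms order_refl] by blast
next
  obtain e where e: "e \<ge> 1" "Phi_star n e I \<subseteq> I"
    using Phi_star_stabilizes[OF assms] by blast
  have "Phi_star n q I = I" if "q \<ge> e" for q
    using Phi_star_antimono[OF that, of n I] e(2) subset_Phi_star[of I n q] by blast
  then show "\<exists>e\<ge>1. \<forall>q\<ge>e. Phi_star n q I = I"
    using e(1) by blast
  show "(\<Inter>q\<in>{1..}. Phi_star n q I) = I"
    using e subset_Phi_star[of I n] by blast
qed

end
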